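(* Let $\Gamma$ be a simple graph of order $n>0$ with $c$ connected components, let $\mathfrak{G}$ be a finite group of order $\gamma>0$, and let $i\in\{0,1,\dots,n\}$. Then the signless Whitney number $\bar w_i(\mathfrak{G}\cdot\Gamma^{(V)})$ is a polynomial function of $\gamma$ of degree $\min(i,n-c)$, with positive coefficients; namely, $$\bar w_i(\mathfrak{G}\cdot\Gamma^{(V)}) = \sum_{0\le j\le i} \bar w_j(\Gamma)\binom{n-j}{i-j}\gamma^j .$$
   Context: A gain graph $\Phi$ over a group $\mathfrak{G}$ consists of a graph (possibly with half edges, i.e. edges with only one endpoint) on vertex set $V$, $|V|=n$, together with a map $\phi$ assigning to each oriented (ordinary) edge an element of $\mathfrak{G}$ such that reversing the orientation inverts the gain. The gain of a circle $C=e_1e_2\cdots e_l$ (traversed in a direction) is $\phi(e_1)\cdots\phi(e_l)$; $C$ is neutral if this is the identity (this property does not depend on starting point or direction). An edge set is balanced if it contains no half edges and every circle in it is neutral. For $S\subseteq E(\Phi)$, $b(S)$ denotes the number of connected components of the spanning subgraph $(V,S)$ whose edge sets are balanced. The chromatic polynomial is $\chi_\Phi(\lambda)=\sum_{S\subseteq E(\Phi)}(-1)^{|S|}\lambda^{b(S)}$, the signless chromatic polynomial is $\bar\chi_\Phi(\lambda)=(-1)^n\chi_\Phi(-\lambda)$, and the signless Whitney numbers $\bar w_i(\Phi)$ are defined by $\bar\chi_\Phi(\lambda)=\sum_{i=0}^{n}\bar w_i(\Phi)\lambda^{n-i}$. For an ordinary graph $\Gamma$ of order $n$, $\bar w_j(\Gamma)$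 is defined in the same way from its usual chromatic polynomial $\chi_\Gamma$ (equivalently, from $\Gamma$ with all gains trivial), i.e. $(-1)^n\chi_\Gamma(-\lambda)=\sum_j \bar w_j(\Gamma)\lambda^{n-j}$. The $\mathfrak{G}$-expansion $\mathfrak{G}\cdot\Gamma$ of a graph $\Gamma=(V,E)$ is the gain graph on vertex set $V$ having, for each edge $e\in E$ (with a fixed orientation) and each $g\in\mathfrak{G}$, an edge $ge$ with the same endpoints and gain $g$ in that orientation. For $X\subseteq V$, $\mathfrak{G}\cdot\Gamma^{(X)}$ is $\mathfrak{G}\cdot\Gamma$ with one half edge added at each vertex of $X$; $\mathfrak{G}\cdot\Gamma^{(V)}$ is the full $\mathfrak{G}$-expansion. *)

theory Defs
  imports
    "HOL-Library.FuncSet"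
    "HOL-Computational_Algebra.Polynomial"
    "HOL-Algebra.Coset"
begin

definition simple_graph :: "'v set \<Rightarrow> 'v set set \<Rightarrow> bool" where
  "simple_graph V E \<longleftrightarrow> finite V \<and> (\<forall>e\<in>E. e \<subseteq> V \<and> card e = 2)"

definition conn_classes :: "'v set \<Rightarrow> ('v \<times> 'v) set \<Rightarrow> 'v set set" where
  "conn_classes V R = V // {(u, v). u \<in> V \<and> v \<in> V \<and> (u, v) \<in> (R \<union> R\<inverse>)\<^sup>*}"

definition graph_components :: "'v set \<Rightarrow> 'v set set \<Rightarrow> 'v set set" where
  "graph_components V E = conn_classes V {(u, v). {u, v} \<in> E}"

definition proper_colorings :: "'v set \<Rightarrow> 'v set set \<Rightarrow> nat \<Rightarrow> ('v \<Rightarrow> nat) set" where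
  "proper_colorings V E k =
     {f \<in> V \<rightarrow>\<^sub>E {..<k}. \<forall>u\<in>V. \<forall>v\<in>V. {u, v} \<in> E \<longrightarrow> f u \<noteq> f v}"

definition graph_chromatic_poly :: "'v set \<Rightarrow> 'v set set \<Rightarrow> int poly" where
  "graph_chromatic_poly V E =
     (THE p. \<forall>k. poly p (int k) = int (card (proper_colorings V E k)))"

text \<open>
  Each ordinary edge \<open>e\<close> carries a reference direction, from \<open>tail e\<close> to \<open>head e\<close>; the oriented edge
  \<open>(e, True)\<close> is \<open>e\<close> in that direction and \<open>(e, False)\<close> is \<open>e\<close> reversed. Loops and parallel edges are
  allowed. A half edge has its single endpoint as both tail and head, and its gain is meaningless.
\<close>

record ('v, 'e, 'g) gain_graph =
  verts :: "'v set"
  edges :: "'e set"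
  half :: "'e \<Rightarrow> bool"
  tail :: "'e \<Rightarrow> 'v"
  head :: "'e \<Rightarrow> 'v"
  gain :: "'e \<times> bool \<Rightarrow> 'g"

definition is_gain_graph :: "('g, 'm) monoid_scheme \<Rightarrow> ('v, 'e, 'g) gain_graph \<Rightarrow> bool" where
  "is_gain_graph G \<Phi> \<longleftrightarrow> group G \<and> finite (verts \<Phi>) \<and>
     (\<forall>e\<in>edges \<Phi>. tail \<Phi> e \<in> verts \<Phi> \<and> head \<Phi> e \<in> verts \<Phi> \<and>
        (if half \<Phi> e then tail \<Phi> e = head \<Phi> e
         else (\<forall>d. gain \<Phi> (e, d) \<in> carrier G \<and>
                   gain \<Phi> (e, \<not> d) = inv\<^bsub>G\<^esub> (gain \<Phi> (e, d)))))"

definition source :: "('v, 'e, 'g) gain_graph \<Rightarrow> 'e \<times> bool \<Rightarrow> 'v" where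
  "source \<Phi> a = (if snd a then tail \<Phi> (fst a) else head \<Phi> (fst a))"

definition target :: "('v, 'e, 'g) gain_graph \<Rightarrow> 'e \<times> bool \<Rightarrow> 'v" where
  "target \<Phi> a = (if snd a then head \<Phi> (fst a) else tail \<Phi> (fst a))"

text \<open>
  A circle with a starting point and a direction. Length 1 is a loop; at length 2 distinctness of the
  edges excludes going back and forth along one edge.
\<close>

definition circle :: "('v, 'e, 'g) gain_graph \<Rightarrow> 'e set \<Rightarrow> ('e \<times> bool) list \<Rightarrow> bool" where
  "circle \<Phi> S C \<longleftrightarrow> C \<noteq> [] \<and>
     (\<forall>a\<in>set C. fst a \<in> S \<and> \<not> half \<Phi> (fst a)) \<and>
     distinct (map fst C) \<and> distinct (map (source \<Phi>) C) \<and>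
     (\<forall>k<length C. target \<Phi> (C ! k) = source \<Phi> (C ! (Suc k mod length C)))"

definition circle_gain ::
  "('g, 'm) monoid_scheme \<Rightarrow> ('v, 'e, 'g) gain_graph \<Rightarrow> ('e \<times> bool) list \<Rightarrow> 'g" where
  "circle_gain G \<Phi> C = foldr (\<lambda>a x. gain \<Phi> a \<otimes>\<^bsub>G\<^esub> x) C \<one>\<^bsub>G\<^esub>"

definition balanced ::
  "('g, 'm) monoid_scheme \<Rightarrow> ('v, 'e, 'g) gain_graph \<Rightarrow> 'e set \<Rightarrow> bool" where
  "balanced G \<Phi> S \<longleftrightarrow> (\<forall>e\<in>S. \<not> half \<Phi> e) \<and>
     (\<forall>C. circle \<Phi> S C \<longrightarrow> circle_gain G \<Phi> C = \<one>\<^bsub>G\<^esub>)"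

definition components :: "('v, 'e, 'g) gain_graph \<Rightarrow> 'e set \<Rightarrow> 'v set set" where
  "components \<Phi> S = conn_classes (verts \<Phi>) {(tail \<Phi> e, head \<Phi> e) | e. e \<in> S}"

definition balanced_count ::
  "('g, 'm) monoid_scheme \<Rightarrow> ('v, 'e, 'g) gain_graph \<Rightarrow> 'e set \<Rightarrow> nat" where
  "balanced_count G \<Phi> S =
     card {B \<in> components \<Phi> S. balanced G \<Phi> {e \<in> S. tail \<Phi> e \<in> B \<and> head \<Phi> e \<in> B}}"

definition gain_chromatic_poly ::
  "('g, 'm) monoid_scheme \<Rightarrow> ('v, 'e, 'g) gain_graph \<Rightarrow> int poly" where
  "gain_chromatic_poly G \<Phi> =
     (\<Sum>S\<in>Pow (edges \<Phi>). monom ((- 1) ^ card S) (balanced_count G \<Phi> S))"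

definition signless_poly :: "nat \<Rightarrow> int poly \<Rightarrow> int poly" where
  "signless_poly n p = smult ((- 1) ^ n) (pcompose p [:0, - 1:])"

definition gain_whitney ::
  "('g, 'm) monoid_scheme \<Rightarrow> ('v, 'e, 'g) gain_graph \<Rightarrow> nat \<Rightarrow> int" where
  "gain_whitney G \<Phi> i =
     coeff (signless_poly (card (verts \<Phi>)) (gain_chromatic_poly G \<Phi>)) (card (verts \<Phi>) - i)"

definition graph_whitney :: "'v set \<Rightarrow> 'v set set \<Rightarrow> nat \<Rightarrow> int" where
  "graph_whitney V E j = coeff (signless_poly (card V) (graph_chromatic_poly V E)) (card V - j)"

definition orients :: "('v set \<Rightarrow> 'v \<times> 'v) \<Rightarrow> 'v set set \<Rightarrow> bool" where
  "orients ori E \<longleftrightarrow> (\<forall>e\<in>E. {fst (ori e), snd (ori e)} = e)"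

text \<open>\<open>Inl (g, e)\<close> is the edge \<open>ge\<close>, and \<open>Inr v\<close> is the half edge at \<open>v\<close>.\<close>

definition expansion ::
  "('g, 'm) monoid_scheme \<Rightarrow> 'v set \<Rightarrow> 'v set set \<Rightarrow> ('v set \<Rightarrow> 'v \<times> 'v) \<Rightarrow> 'v set
     \<Rightarrow> ('v, ('g \<times> 'v set) + 'v, 'g) gain_graph" where
  "expansion G V E ori X =
     \<lparr> verts = V,
       edges = Inl ` (carrier G \<times> E) \<union> Inr ` X,
       half = (\<lambda>x. case x of Inl _ \<Rightarrow> False | Inr _ \<Rightarrow> True),
       tail = (\<lambda>x. case x of Inl (g, e) \<Rightarrow> fst (ori e) | Inr v \<Rightarrow> v),
       head = (\<lambda>x. case x of Inl (g, e) \<Rightarrow> snd (ori e) | Inr v \<Rightarrow> v),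
       gain = (\<lambda>(x, d). case x of Inl (g, e) \<Rightarrow> if d then g else inv\<^bsub>G\<^esub> g | Inr _ \<Rightarrow> \<one>\<^bsub>G\<^esub>) \<rparr>"

abbreviation full_expansion ::
  "('g, 'm) monoid_scheme \<Rightarrow> 'v set \<Rightarrow> 'v set set \<Rightarrow> ('v set \<Rightarrow> 'v \<times> 'v)
     \<Rightarrow> ('v, ('g \<times> 'v set) + 'v, 'g) gain_graph" where
  "full_expansion G V E ori \<equiv> expansion G V E ori V"

lemma is_gain_graph_expansion:
  assumes "group G" "simple_graph V E" "orients ori E" "X \<subseteq> V"
  shows "is_gain_graph G (expansion G V E ori X)"
proof -
  have "fst (ori e) \<in> V \<and> snd (ori e) \<in> V" if "e \<in> E" for e
    using assms that unfolding simple_graph_def orients_def by blast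
  then show ?thesis
    using assms by (auto simp: is_gain_graph_def expansion_def simple_graph_def
        group.inv_closed group.inv_inv)
qed

lemma card_proper_colorings_contract:
  assumes sg: "simple_graph V E" and e: "{u, v} \<in> E" and uv: "u \<noteq> v"
  defines "m \<equiv> \<lambda>x. if x = v then u else x"
  shows "card {f \<in> proper_colorings V (E - {{u, v}}) k. f u = f v}
       = card (proper_colorings (V - {v}) ((`) m ` (E - {{u, v}})) k)"
    (is "card ?A = card ?B")
proof -
  have u: "u \<in> V" and v: "v \<in> V" using sg e by (auto simp: simple_graph_def)
  have "bij_betw (\<lambda>f. restrict f (V - {v})) ?A ?B"
  proof (rule bij_betw_byWitness[where f' = "\<lambda>g. g(v := g u)"])
    show "\<forall>f\<in>?A. (restrict f (V - {v}))(v := restrict f (V - {v}) u) = f"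
      using u v uv by (auto simp: proper_colorings_def PiE_iff extensional_def restrict_def fun_eq_iff)
    show "\<forall>g\<in>?B. restrict (g(v := g u)) (V - {v}) = g"
      by (auto simp: proper_colorings_def PiE_iff extensional_def restrict_def fun_eq_iff)
    show "(\<lambda>f. restrict f (V - {v})) ` ?A \<subseteq> ?B"
    proof
      fix g assume "g \<in> (\<lambda>f. restrict f (V - {v})) ` ?A"
      then obtain f where f: "f \<in> ?A" and g: "g = restrict f (V - {v})" by blast
      have fm: "f (m x) = f x" for x using f by (auto simp: m_def)
      have "g x \<noteq> g y" if xy: "x \<in> V - {v}" "y \<in> V - {v}"
        and xyE: "{x, y} \<in> (`) m ` (E - {{u, v}})" for x y
      proof -
        obtain d where d: "d \<in> E" "d \<noteq> {u, v}" "{x, y} = m ` d" using xyE by blast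
        obtain a b where ab: "d = {a, b}" using sg d(1) by (auto simp: simple_graph_def card_2_iff)
        have "a \<in> V" "b \<in> V" using sg d(1) ab by (auto simp: simple_graph_def)
        then have ne: "f a \<noteq> f b" using f d ab by (auto simp: proper_colorings_def)
        have "{f x, f y} = f ` {x, y}" by simp
        also have "\<dots> = {f a, f b}" using d(3) ab fm by (simp)
        finally have "f x \<noteq> f y" using ne by (auto simp: doubleton_eq_iff)
        then show ?thesis using g xy by simp
      qed
      moreover have "g \<in> (V - {v}) \<rightarrow>\<^sub>E {..<k}" using f g by (auto simp: proper_colorings_def)
      ultimately show "g \<in> ?B" by (simp add: proper_colorings_def)
    qed
    show "(\<lambda>g. g(v := g u)) ` ?B \<subseteq> ?A"
    proof
      fix f assume "f \<in> (\<lambda>g. g(v := g u)) ` ?B"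
      then obtain g where g: "g \<in> ?B" and f: "f = g(v := g u)" by blast
      have fm: "f x = g (m x)" for x using f uv by (simp add: m_def)
      have "f x \<noteq> f y" if xy: "x \<in> V" "y \<in> V" and d: "{x, y} \<in> E - {{u, v}}" for x y
      proof -
        have "m x \<in> V - {v}" "m y \<in> V - {v}" using xy u uv by (auto simp: m_def)
        moreover have "{m x, m y} \<in> (`) m ` (E - {{u, v}})"
          using imageI[OF d, of "(`) m"] by simp
        ultimately have "g (m x) \<noteq> g (m y)" using g unfolding proper_colorings_def by blast
        then show ?thesis by (simp add: fm)
      qed
      moreover have "f \<in> V \<rightarrow>\<^sub>E {..<k}"
        using g f u v uv by (auto simp: proper_colorings_def PiE_iff extensional_def)
      ultimately show "f \<in> ?A" using f uv by (auto simp: proper_colorings_def)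
    qed
  qed
  then show ?thesis by (rule bij_betw_same_card)
qed

lemma finite_proper_colorings: "finite V \<Longrightarrow> finite (proper_colorings V E k)"
  unfolding proper_colorings_def by (rule finite_subset[of _ "V \<rightarrow>\<^sub>E {..<k}"]) (auto intro: finite_PiE)

lemma simple_graph_finite_edges: "simple_graph V E \<Longrightarrow> finite E"
  unfolding simple_graph_def by (rule finite_subset[of _ "Pow V"]) auto

lemma chromatic_poly_exists:
  assumes "simple_graph V E"
  shows "\<exists>p :: int poly. degree p \<le> card V \<and>
           (\<forall>k. poly p (int k) = int (card (proper_colorings V E k)))"
  using assms
proof (induction "card E" arbitrary: V E rule: less_induct)
  case less
  have finV: "finite V" and finE: "finite E"
    using less.prems simple_graph_finite_edges by (auto simp: simple_graph_def)
  show ?case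
  proof (cases "E = {}")
    case True
    then have "card (proper_colorings V E k) = k ^ card V" for k
      using finV by (simp add: proper_colorings_def card_PiE)
    then show ?thesis
      by (intro exI[of _ "monom 1 (card V)"]) (simp add: poly_monom degree_monom_le)
  next
    case False
    then obtain e where e: "e \<in> E" by blast
    then obtain u v where uv: "e = {u, v}" "u \<noteq> v"
      using less.prems by (auto simp: simple_graph_def card_2_iff)
    define m where "m = (\<lambda>x. if x = v then u else x)"
    let ?E1 = "E - {{u, v}}" and ?E2 = "(`) m ` (E - {{u, v}})"
    have uV: "u \<in> V" "v \<in> V" using less.prems e uv by (auto simp: simple_graph_def)
    have c1: "card ?E1 < card E" using e uv finE by (intro psubset_card_mono) auto
    have c2: "card ?E2 < card E" using c1 card_image_le[of ?E1 "(`) m"] finE by simp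
    have s1: "simple_graph V ?E1" using less.prems by (auto simp: simple_graph_def)
    have s2: "simple_graph (V - {v}) ?E2"
    proof -
      have "m ` d \<subseteq> V - {v} \<and> card (m ` d) = 2" if d: "d \<in> E" "d \<noteq> {u, v}" for d
      proof -
        have dd: "d \<subseteq> V" "card d = 2" using less.prems d by (auto simp: simple_graph_def)
        then obtain a b where ab: "d = {a, b}" "a \<noteq> b" by (auto simp: card_2_iff)
        then have "m a \<noteq> m b" using d by (auto simp: m_def)
        then have "card (m ` d) = 2" by (simp add: ab(1))
        moreover have "m x \<in> V - {v}" if "x \<in> V" for x using that uV uv(2) by (simp add: m_def)
        ultimately show ?thesis using dd(1) by blast
      qed
      then have "\<forall>d\<in>?E2. d \<subseteq> V - {v} \<and> card d = 2" by simp
      then show ?thesis using finV by (simp add: simple_graph_def)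
    qed
    obtain p1 :: "int poly" where p1: "degree p1 \<le> card V"
      "\<And>k. poly p1 (int k) = int (card (proper_colorings V ?E1 k))"
      using less.hyps[OF c1 s1] by blast
    obtain p2 :: "int poly" where p2: "degree p2 \<le> card (V - {v})"
      "\<And>k. poly p2 (int k) = int (card (proper_colorings (V - {v}) ?E2 k))"
      using less.hyps[OF c2 s2] by blast
    have "card (V - {v}) \<le> card V" using finV by (simp add: card_mono)
    then have "degree (p1 - p2) \<le> card V" using p1(1) p2(1) by (intro degree_diff_le) auto
    moreover have "poly (p1 - p2) (int k) = int (card (proper_colorings V E k))" for k
    proof -
      let ?A = "{f \<in> proper_colorings V ?E1 k. f u = f v}"
      have eE: "{u, v} \<in> E" using e uv(1) by simp
      have iff: "f \<in> proper_colorings V E k \<longleftrightarrow> f \<in> proper_colorings V ?E1 k \<and> f u \<noteq> f v" for f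
      proof
        assume "f \<in> proper_colorings V E k"
        then show "f \<in> proper_colorings V ?E1 k \<and> f u \<noteq> f v"
          using eE uV unfolding proper_colorings_def by simp
      next
        assume f: "f \<in> proper_colorings V ?E1 k \<and> f u \<noteq> f v"
        have "f x \<noteq> f y" if "x \<in> V" "y \<in> V" "{x, y} \<in> E" for x y
        proof (cases "{x, y} = {u, v}")
          case True
          then show ?thesis using f by (metis doubleton_eq_iff)
        next
          case False
          then show ?thesis using f that unfolding proper_colorings_def by simp
        qed
        then show "f \<in> proper_colorings V E k" using f unfolding proper_colorings_def by simp
      qed
      have "proper_colorings V ?E1 k = proper_colorings V E k \<union> ?A"
        by (intro Set.set_eqI) (metis (mono_tags, lifting) Un_iff mem_Collect_eq iff)
      moreover have "proper_colorings V E k \<inter> ?A = {}"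
        by (intro equals0I) (metis (mono_tags, lifting) Int_iff mem_Collect_eq iff)
      ultimately have "card (proper_colorings V ?E1 k) = card (proper_colorings V E k) + card ?A"
        using finite_proper_colorings[OF finV] card_Un_disjoint[of "proper_colorings V E k" ?A]
        by simp
      moreover have "card ?A = card (proper_colorings (V - {v}) ?E2 k)"
        using card_proper_colorings_contract[of V E u v k] less.prems e uv by (simp add: m_def)
      ultimately show ?thesis by (simp add: p1(2) p2(2))
    qed
    ultimately show ?thesis by blast
  qed
qed

lemma int_poly_eqI_nat:
  fixes p q :: "int poly"
  assumes "\<And>k :: nat. poly p (int k) = poly q (int k)"
  shows "p = q"
proof (rule ccontr)
  assume "p \<noteq> q"
  then have "finite {x. poly (p - q) x = 0}" by (intro poly_roots_finite) simp
  moreover have "range int \<subseteq> {x. poly (p - q) x = 0}" using assms by auto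
  ultimately have "finite (range int)" by (rule rev_finite_subset)
  then show False using finite_imageD[of int UNIV] by simp
qed

lemma graph_chromatic_poly:
  assumes "simple_graph V E"
  shows poly_graph_chromatic_poly:
      "poly (graph_chromatic_poly V E) (int k) = int (card (proper_colorings V E k))"
    and degree_graph_chromatic_poly: "degree (graph_chromatic_poly V E) \<le> card V"
proof -
  obtain p :: "int poly" where p: "degree p \<le> card V"
    "\<forall>k. poly p (int k) = int (card (proper_colorings V E k))"
    using chromatic_poly_exists[OF assms] by blast
  have "graph_chromatic_poly V E = p"
    unfolding graph_chromatic_poly_def
    by (rule the_equality) (use p int_poly_eqI_nat in auto)
  then show "poly (graph_chromatic_poly V E) (int k) = int (card (proper_colorings V E k))"
    and "degree (graph_chromatic_poly V E) \<le> card V" using p by auto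
qed

lemma degree_gain_chromatic_poly:
  assumes "finite (verts \<Phi>)"
  shows "degree (gain_chromatic_poly G \<Phi>) \<le> card (verts \<Phi>)"
proof -
  have "balanced_count G \<Phi> S \<le> card (verts \<Phi>)" for S
  proof -
    have *: "components \<Phi> S = (\<lambda>x. {(u, v). u \<in> verts \<Phi> \<and> v \<in> verts \<Phi> \<and>
        (u, v) \<in> ({(tail \<Phi> e, head \<Phi> e) | e. e \<in> S} \<union> {(tail \<Phi> e, head \<Phi> e) | e. e \<in> S}\<inverse>)\<^sup>*} `` {x})
        ` verts \<Phi>"
      unfolding components_def conn_classes_def quotient_def by blast
    have "finite (components \<Phi> S)" "card (components \<Phi> S) \<le> card (verts \<Phi>)"
      unfolding * using assms by (auto intro: card_image_le)
    moreover have "balanced_count G \<Phi> S \<le> card (components \<Phi> S)"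
      unfolding balanced_count_def by (rule card_mono[OF calculation(1)]) (rule Collect_subset)
    ultimately show ?thesis by linarith
  qed
  then show ?thesis
    unfolding gain_chromatic_poly_def
    by (cases "finite (Pow (edges \<Phi>))")
      (auto intro!: degree_sum_le order_trans[OF degree_monom_le])
qed

lemma poly_eq_sum_reversed:
  fixes p :: "int poly"
  assumes "degree p \<le> n"
  shows "p = (\<Sum>i\<le>n. monom (coeff p (n - i)) (n - i))"
proof -
  have "p = (\<Sum>i\<le>n. monom (coeff p i) i)" using poly_as_sum_of_monoms'[OF assms] by simp
  also have "\<dots> = (\<Sum>i\<le>n. monom (coeff p (n - i)) (n - i))"
    by (rule sum.reindex_bij_witness[of _ "\<lambda>i. n - i" "\<lambda>i. n - i"]) auto
  finally show ?thesis .
qed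

lemma degree_signless_poly: "degree (signless_poly n p) \<le> degree p"
  unfolding signless_poly_def
  by (rule order_trans[OF degree_smult_le]) (simp add: degree_pcompose)

lemma signless_gain_chromatic_poly:
  assumes "finite (verts \<Phi>)"
  defines "n \<equiv> card (verts \<Phi>)"
  shows "signless_poly n (gain_chromatic_poly G \<Phi>) = (\<Sum>i\<le>n. monom (gain_whitney G \<Phi> i) (n - i))"
  unfolding gain_whitney_def n_def
  by (rule poly_eq_sum_reversed)
    (rule order_trans[OF degree_signless_poly degree_gain_chromatic_poly[OF assms(1)]])

lemma signless_graph_chromatic_poly:
  assumes "simple_graph V E"
  defines "n \<equiv> card V"
  shows "signless_poly n (graph_chromatic_poly V E) = (\<Sum>j\<le>n. monom (graph_whitney V E j) (n - j))"
  unfolding graph_whitney_def n_def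
  by (rule poly_eq_sum_reversed)
    (rule order_trans[OF degree_signless_poly degree_graph_chromatic_poly[OF assms(1)]])

end

theory Submission
  imports Defs
begin

text \<open>
  Color the vertices of a gain graph \<open>\<Phi>\<close> by a zero color and the elements of
  \<open>G \<times> {0,\<dots>,k-1}\<close>, on which \<open>G\<close> acts freely. Switching by a potential of the balanced
  components of \<open>S\<close> turns the colorings that are improper on every edge of \<open>S\<close> into those that are
  constant on each balanced component and zero on the others, so there are \<open>(1 + \<gamma>k)^b(S)\<close> of them;
  by inclusion-exclusion \<open>\<chi>\<^sub>\<Phi>(1 + \<gamma>k)\<close> counts the proper colorings. In the full expansion the half
  edges forbid zero, and the edges \<open>ge\<close> together say that the second components at the ends of \<open>e\<close>
  differ, while the group components are free. Hence \<open>\<chi>\<^sub>\<Phi>(1 + \<gamma>\<lambda>) = \<gamma>^n \<chi>\<^sub>\<Gamma>(\<lambda>)\<close>, and comparing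
  coefficients gives the formula. Deletion and contraction show that the \<open>j\<close>-th signless Whitney
  number of \<open>\<Gamma>\<close> is positive for \<open>j \<le> n - c\<close> and zero beyond.
\<close>

section \<open>Counting\<close>

lemma card_image_eq_if_same_kernel:
  assumes "\<And>x y. x \<in> A \<Longrightarrow> y \<in> A \<Longrightarrow> f x = f y \<longleftrightarrow> g x = g y"
  shows "card (f ` A) = card (g ` A)"
proof (rule bij_betw_same_card)
  let ?r = "inv_into A f"
  have r: "?r X \<in> A" "f (?r X) = X" if "X \<in> f ` A" for X
    using that by (simp_all add: inv_into_into f_inv_into_f)
  show "bij_betw (\<lambda>X. g (?r X)) (f ` A) (g ` A)"
  proof (rule bij_betw_imageI)
    show "inj_on (\<lambda>X. g (?r X)) (f ` A)"
      by (rule inj_onI) (metis assms r)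
    have "g (?r (f x)) = g x" if "x \<in> A" for x
      using r[of "f x"] assms[of "?r (f x)" x] that by simp
    then show "(\<lambda>X. g (?r X)) ` f ` A = g ` A"
      by (simp add: image_image)
  qed
qed

lemma card_quotient_eq:
  assumes r: "equiv A r" and s: "equiv B s" and surj: "m ` A = B"
    and iff: "\<And>x y. x \<in> A \<Longrightarrow> y \<in> A \<Longrightarrow> (x, y) \<in> r \<longleftrightarrow> (m x, m y) \<in> s"
  shows "card (A // r) = card (B // s)"
proof -
  have "r `` {x} = r `` {y} \<longleftrightarrow> s `` {m x} = s `` {m y}" if "x \<in> A" "y \<in> A" for x y
  proof -
    have "m x \<in> B" "m y \<in> B" using that surj by auto
    then show ?thesis
      using that by (simp add: eq_equiv_class_iff[OF r] eq_equiv_class_iff[OF s] iff)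
  qed
  then have "card ((\<lambda>x. r `` {x}) ` A) = card ((\<lambda>x. s `` {m x}) ` A)"
    by (rule card_image_eq_if_same_kernel)
  moreover have "A // r = (\<lambda>x. r `` {x}) ` A" "B // s = (\<lambda>x. s `` {m x}) ` A"
    by (auto simp: quotient_def simp flip: surj)
  ultimately show ?thesis by simp
qed

definition class_functions :: "'a set \<Rightarrow> 'b set \<Rightarrow> ('a \<times> 'a) set \<Rightarrow> 'a set set \<Rightarrow> 'b \<Rightarrow>
    ('a \<Rightarrow> 'b) set" where
  "class_functions A C r D z =
     {f \<in> A \<rightarrow>\<^sub>E C. (\<forall>x y. (x, y) \<in> r \<longrightarrow> f x = f y) \<and> (\<forall>x\<in>A. r `` {x} \<notin> D \<longrightarrow> f x = z)}"

definition pull_classes :: "'a set \<Rightarrow> ('a \<times> 'a) set \<Rightarrow> 'a set set \<Rightarrow> 'b \<Rightarrow>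
    ('a set \<Rightarrow> 'b) \<Rightarrow> 'a \<Rightarrow> 'b" where
  "pull_classes A r D z g = (\<lambda>x\<in>A. if r `` {x} \<in> D then g (r `` {x}) else z)"

lemma inj_on_pull_classes:
  assumes "D \<subseteq> A // r"
  shows "inj_on (pull_classes A r D z) (D \<rightarrow>\<^sub>E C)"
proof (rule inj_onI)
  fix g h assume g: "g \<in> D \<rightarrow>\<^sub>E C" and h: "h \<in> D \<rightarrow>\<^sub>E C"
    and eq: "pull_classes A r D z g = pull_classes A r D z h"
  have "g X = h X" if X: "X \<in> D" for X
  proof -
    obtain x where "x \<in> A" "X = r `` {x}" using X assms by (blast elim: quotientE)
    then show ?thesis using X fun_cong[OF eq, of x] by (simp add: pull_classes_def)
  qed
  then show "g = h" by (rule PiE_ext[OF g h])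
qed

lemma pull_classes_image:
  assumes r: "equiv A r" and D: "D \<subseteq> A // r" and z: "z \<in> C"
  shows "pull_classes A r D z ` (D \<rightarrow>\<^sub>E C) = class_functions A C r D z"
proof (intro equalityI image_subsetI subsetI)
  fix g assume g: "g \<in> D \<rightarrow>\<^sub>E C"
  have "pull_classes A r D z g x = pull_classes A r D z g y" if "(x, y) \<in> r" for x y
    using that equiv_type[OF r] equiv_class_eq[OF r that] by (auto simp: pull_classes_def)
  moreover have "pull_classes A r D z g \<in> A \<rightarrow>\<^sub>E C"
    using g z by (auto simp: pull_classes_def)
  ultimately show "pull_classes A r D z g \<in> class_functions A C r D z"
    by (simp add: class_functions_def pull_classes_def)
next
  fix f assume f: "f \<in> class_functions A C r D z"
  define g where "g = (\<lambda>X\<in>D. f (SOME x. x \<in> X))"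
  have rep: "f (SOME y. y \<in> r `` {x}) = f x" if "x \<in> A" for x
  proof -
    have "(x, SOME y. y \<in> r `` {x}) \<in> r"
      using someI[of "\<lambda>y. y \<in> r `` {x}", OF equiv_class_self[OF r that]] by simp
    then have "f x = f (SOME y. y \<in> r `` {x})"
      using f unfolding class_functions_def by blast
    then show ?thesis by simp
  qed
  have "g X \<in> C" if X: "X \<in> D" for X
  proof -
    obtain x where "x \<in> A" "X = r `` {x}" using X D by (blast elim: quotientE)
    then show ?thesis using f X rep[of x] by (auto simp: g_def class_functions_def)
  qed
  then have "g \<in> D \<rightarrow>\<^sub>E C" by (auto simp: g_def)
  moreover have "f x = pull_classes A r D z g x" for x
    using f rep[of x] by (cases "x \<in> A") (auto simp: g_def pull_classes_def class_functions_def)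
  ultimately show "f \<in> pull_classes A r D z ` (D \<rightarrow>\<^sub>E C)" by blast
qed

lemma card_class_functions:
  assumes "equiv A r" "finite A" "D \<subseteq> A // r" "z \<in> C"
  shows "card (class_functions A C r D z) = card C ^ card D"
proof -
  have "card (class_functions A C r D z) = card (D \<rightarrow>\<^sub>E C)"
    using card_image[OF inj_on_pull_classes[OF assms(3)]] pull_classes_image[OF assms(1,3,4)]
    by metis
  moreover have "finite D"
    using finite_subset[OF assms(3)] finite_quotient[OF assms(2) equiv_type[OF assms(1)]] by simp
  ultimately show ?thesis by (simp add: card_PiE)
qed

lemma bij_betw_PiE_Some_Pair:
  "bij_betw (\<lambda>(g, h). \<lambda>x\<in>X. Some (g x, h x)) ((X \<rightarrow>\<^sub>E A) \<times> (X \<rightarrow>\<^sub>E B)) (X \<rightarrow>\<^sub>E Some ` (A \<times> B))"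
    (is "bij_betw ?pair ?GH ?F")
proof (rule bij_betw_byWitness)
  let ?unpair = "\<lambda>f. (\<lambda>x\<in>X. fst (the (f x)), \<lambda>x\<in>X. snd (the (f x)))"
  have components: "fst (the (f x)) \<in> A" "snd (the (f x)) \<in> B"
    "Some (fst (the (f x)), snd (the (f x))) = f x" if "f \<in> ?F" "x \<in> X" for f x
    using PiE_mem[OF that] by auto
  show "\<forall>gh\<in>?GH. ?unpair (?pair gh) = gh"
    by (auto simp: PiE_iff extensional_def fun_eq_iff)
  show "\<forall>f\<in>?F. ?pair (?unpair f) = f"
  proof
    fix f assume f: "f \<in> ?F"
    have "?pair (?unpair f) x = f x" for x
      using components(3)[OF f] PiE_arb[OF f] by (cases "x \<in> X") simp_all
    then show "?pair (?unpair f) = f" ..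
  qed
  show "?pair ` ?GH \<subseteq> ?F" by auto
  show "?unpair ` ?F \<subseteq> ?GH" using components(1,2) by auto
qed

lemma int_card_avoiding_all:
  assumes A: "finite A" and X: "finite X"
  shows "int (card {x \<in> X. \<forall>a\<in>A. \<not> P a x}) =
    (\<Sum>S\<in>Pow A. (- 1) ^ card S * int (card {x \<in> X. \<forall>a\<in>S. P a x}))"
proof -
  let ?i = "\<lambda>Q. if Q then 1 else 0 :: int"
  have count: "int (card {x \<in> X. Q x}) = (\<Sum>x\<in>X. ?i (Q x))" for Q
    using sum.inter_filter[OF X, of "\<lambda>_. 1 :: int" Q] by simp
  have indicator_all: "(\<Prod>a\<in>S. ?i (Q a)) = ?i (\<forall>a\<in>S. Q a)" if "S \<subseteq> A" for S Q
    using finite_subset[OF that A] by (induction S) auto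
  have "?i (\<forall>a\<in>A. \<not> P a x) = (\<Sum>S\<in>Pow A. (- 1) ^ card S * ?i (\<forall>a\<in>S. P a x))" for x
  proof -
    have "?i (\<forall>a\<in>A. \<not> P a x) = (\<Prod>a\<in>A. - ?i (P a x) + 1)"
      by (subst indicator_all[symmetric]) (auto intro: prod.cong)
    also have "\<dots> = (\<Sum>S\<in>Pow A. \<Prod>a\<in>S. - ?i (P a x))"
      using prod_add[OF A, of "\<lambda>a. - ?i (P a x)" "\<lambda>_. 1"] by simp
    also have "\<dots> = (\<Sum>S\<in>Pow A. (- 1) ^ card S * ?i (\<forall>a\<in>S. P a x))"
      by (intro sum.cong) (simp_all only: prod_uminus indicator_all Pow_iff)
    finally show ?thesis .
  qed
  then have "int (card {x \<in> X. \<forall>a\<in>A. \<not> P a x}) =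
      (\<Sum>x\<in>X. \<Sum>S\<in>Pow A. (- 1) ^ card S * ?i (\<forall>a\<in>S. P a x))"
    by (simp only: count)
  also have "\<dots> = (\<Sum>S\<in>Pow A. \<Sum>x\<in>X. (- 1) ^ card S * ?i (\<forall>a\<in>S. P a x))"
    by (rule sum.swap)
  also have "\<dots> = (\<Sum>S\<in>Pow A. (- 1) ^ card S * int (card {x \<in> X. \<forall>a\<in>S. P a x}))"
    by (simp only: count sum_distrib_left)
  finally show ?thesis .
qed

section \<open>Polynomials\<close>

lemma pcompose_linear_cancel:
  fixes p q :: "'a::idom poly"
  assumes "a \<noteq> 0"
  shows "pcompose p [:b, a:] = pcompose q [:b, a:] \<longleftrightarrow> p = q"
  using pcompose_eq_0_iff[of "[:b, a:]" "p - q"] assms by (simp add: pcompose_diff)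

lemma smult_sum_right: "smult a (\<Sum>i\<in>I. f i) = (\<Sum>i\<in>I. smult a (f i))"
  by (induction I rule: infinite_finite_induct) (simp_all add: smult_add_right)

lemma pcompose_power: "pcompose (p ^ n) q = pcompose p q ^ n"
  for p q :: "'a::comm_semiring_1 poly"
  by (induction n) (simp_all add: pcompose_1 pcompose_mult)

lemma coeff_one_plus_X_power:
  "coeff ([:1, 1:] ^ n :: 'a::comm_semiring_1 poly) m = of_nat (n choose m)"
proof (cases "m \<le> n")
  case True
  then show ?thesis by (simp add: coeff_linear_poly_power)
next
  case False
  then show ?thesis by (simp add: coeff_eq_0 degree_linear_power binomial_eq_0)
qed

section \<open>Connection\<close>

definition connection :: "('v \<times> 'v) set \<Rightarrow> ('v \<times> 'v) set" where
  "connection R = (R \<union> R\<inverse>)\<^sup>*"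

definition connection_on :: "'v set \<Rightarrow> ('v \<times> 'v) set \<Rightarrow> ('v \<times> 'v) set" where
  "connection_on V R = {(u, v). u \<in> V \<and> v \<in> V \<and> (u, v) \<in> connection R}"

lemma connection_refl [simp]: "(u, u) \<in> connection R"
  by (simp add: connection_def)

lemma connection_sym: "(u, v) \<in> connection R \<Longrightarrow> (v, u) \<in> connection R"
  unfolding connection_def by (rule symD[OF sym_rtrancl[OF sym_Un_converse]])

lemma connection_trans:
  "(u, v) \<in> connection R \<Longrightarrow> (v, w) \<in> connection R \<Longrightarrow> (u, w) \<in> connection R"
  unfolding connection_def by (rule rtrancl_trans)

lemma connection_base: "(u, v) \<in> R \<Longrightarrow> (u, v) \<in> connection R"
  by (auto simp: connection_def)

lemma connection_invariant:
  assumes "(u, v) \<in> connection R" and "\<And>x y. (x, y) \<in> R \<Longrightarrow> f x = f y"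
  shows "f u = f v"
  using assms(1) unfolding connection_def by (induction rule: rtrancl_induct) (auto dest: assms(2))

lemma connection_mono: "R \<subseteq> R' \<Longrightarrow> connection R \<subseteq> connection R'"
  unfolding connection_def by (intro rtrancl_mono) auto

lemma connection_insert_loop: "connection (insert (u, u) R) = connection R"
  unfolding connection_def by (rule rtrancl_subset) auto

lemma connection_map_prod:
  assumes kernel: "\<And>x y. m x = m y \<Longrightarrow> (x, y) \<in> connection R"
  shows "(m x, m y) \<in> connection (map_prod m m ` R) \<longleftrightarrow> (x, y) \<in> connection R"
proof
  assume "(x, y) \<in> connection R"
  then show "(m x, m y) \<in> connection (map_prod m m ` R)"
    unfolding connection_def
    by (induction rule: rtrancl_induct) (auto 4 4 intro: rtrancl.rtrancl_into_rtrancl)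
next
  have "\<exists>y. z = m y \<and> (x, y) \<in> connection R" if "(m x, z) \<in> connection (map_prod m m ` R)" for z
    using that unfolding connection_def[of "map_prod m m ` R"]
  proof (induction rule: rtrancl_induct)
    case base
    show ?case by (intro exI[of _ x]) simp
  next
    case (step y z)
    from step.hyps(2) consider a b where "y = m a" "z = m b" "(a, b) \<in> R"
      | a b where "y = m a" "z = m b" "(b, a) \<in> R"
      by auto
    then obtain a b where "y = m a" "z = m b" "(a, b) \<in> connection R"
      by cases (blast intro: connection_base connection_sym)+
    moreover obtain a' where "y = m a'" "(x, a') \<in> connection R" using step.IH by blast
    ultimately show ?case using kernel[of a' a] by (metis connection_trans)
  qed
  then show "(x, y) \<in> connection R" if "(m x, m y) \<in> connection (map_prod m m ` R)"
    using that kernel by (metis connection_trans)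
qed

lemma equiv_connection_on: "equiv V (connection_on V R)"
proof (rule equivI)
  show "connection_on V R \<subseteq> V \<times> V" by (auto simp: connection_on_def)
  show "refl_on V (connection_on V R)" by (auto simp: connection_on_def refl_on_def)
  show "sym (connection_on V R)" by (auto simp: connection_on_def sym_def intro: connection_sym)
  show "trans (connection_on V R)"
    by (auto simp: connection_on_def trans_def intro: connection_trans)
qed

lemma conn_classes_eq_quotient: "conn_classes V R = V // connection_on V R"
  by (simp add: conn_classes_def connection_on_def connection_def)

lemma finite_conn_classes: "finite V \<Longrightarrow> finite (conn_classes V R)"
  by (simp add: conn_classes_eq_quotient finite_quotient equiv_type[OF equiv_connection_on])

lemma card_conn_classes_antimono:
  assumes "finite V" "R \<subseteq> R'"
  shows "card (conn_classes V R') \<le> card (conn_classes V R)"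
proof -
  have "connection_on V R \<subseteq> connection_on V R'"
    using connection_mono[OF assms(2)] by (auto simp: connection_on_def)
  then show ?thesis
    using finite_conn_classes[OF assms(1)] unfolding conn_classes_eq_quotient
    by (intro finite_refines_card_le equiv_connection_on)
qed

lemma card_conn_classes_empty: "card (conn_classes V {}) = card V"
proof -
  have "conn_classes V {} = (\<lambda>v. {v}) ` V"
    by (auto simp: conn_classes_eq_quotient quotient_def connection_on_def connection_def)
  then show ?thesis by (simp add: card_image)
qed

lemma card_conn_classes_map_prod:
  assumes "\<And>x y. m x = m y \<Longrightarrow> (x, y) \<in> connection R"
  shows "card (conn_classes (m ` V) (map_prod m m ` R)) = card (conn_classes V R)"
  unfolding conn_classes_eq_quotient
proof (rule card_quotient_eq[OF equiv_connection_on equiv_connection_on, symmetric])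
  show "(x, y) \<in> connection_on V R \<longleftrightarrow>
      (m x, m y) \<in> connection_on (m ` V) (map_prod m m ` R)" if "x \<in> V" "y \<in> V" for x y
    using that connection_map_prod[of m R, OF assms] by (simp add: connection_on_def)
qed simp

section \<open>Colors\<close>

context group
begin

text \<open>The color \<open>None\<close> is the zero color, fixed by the action.\<close>

definition act :: "('a \<times> nat) option \<Rightarrow> 'a \<Rightarrow> ('a \<times> nat) option" where
  "act x g = map_option (\<lambda>(h, i). (h \<otimes> g, i)) x"

definition colors :: "nat \<Rightarrow> ('a \<times> nat) option set" where
  "colors k = insert None (Some ` (carrier G \<times> {..<k}))"

lemma act_None [simp]: "act None g = None"
  and act_Some [simp]: "act (Some (h, i)) g = Some (h \<otimes> g, i)"
  and act_eq_None_iff [simp]: "act x g = None \<longleftrightarrow> x = None"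
  by (simp_all add: act_def)

lemma None_in_colors [simp]: "None \<in> colors k"
  and Some_in_colors_iff [simp]: "Some (h, i) \<in> colors k \<longleftrightarrow> h \<in> carrier G \<and> i < k"
  by (auto simp: colors_def)

lemma colors_cases [consumes 1, case_names None Some]:
  assumes "x \<in> colors k"
  obtains "x = None" | h i where "x = Some (h, i)" "h \<in> carrier G" "i < k"
  using assms by (auto simp: colors_def)

lemma act_closed: "x \<in> colors k \<Longrightarrow> g \<in> carrier G \<Longrightarrow> act x g \<in> colors k"
  by (cases rule: colors_cases) auto

lemma act_act:
  "x \<in> colors k \<Longrightarrow> g \<in> carrier G \<Longrightarrow> h \<in> carrier G \<Longrightarrow> act (act x g) h = act x (g \<otimes> h)"
  by (cases rule: colors_cases) (auto simp: m_assoc)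

lemma act_one: "x \<in> colors k \<Longrightarrow> act x \<one> = x"
  by (cases rule: colors_cases) auto

lemma act_inv_eq_iff:
  assumes "x \<in> colors k" "y \<in> colors k" "g \<in> carrier G"
  shows "act x (inv g) = y \<longleftrightarrow> x = act y g"
  using assms act_act[of x k "inv g" g] act_act[of y k g "inv g"] by (auto simp: act_one)

lemma act_fixed_imp_None: "x \<in> colors k \<Longrightarrow> g \<in> carrier G \<Longrightarrow> g \<noteq> \<one> \<Longrightarrow> act x g = x \<Longrightarrow> x = None"
  by (cases rule: colors_cases) auto

lemma ex_act_Some_iff:
  assumes "g \<in> carrier G" "h \<in> carrier G"
  shows "(\<exists>a\<in>carrier G. Some (h, j) = act (Some (g, i)) a) \<longleftrightarrow> i = j"
proof -
  have "h = g \<otimes> (inv g \<otimes> h)" "inv g \<otimes> h \<in> carrier G"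
    using assms by (simp_all add: m_assoc[symmetric])
  then show ?thesis by auto
qed

lemma finite_colors: "finite (carrier G) \<Longrightarrow> finite (colors k)"
  by (simp add: colors_def)

lemma card_colors: "finite (carrier G) \<Longrightarrow> card (colors k) = 1 + order G * k"
  by (simp add: colors_def card_image order_def card_cartesian_product)

end

section \<open>Walks and circles\<close>

locale finite_gain_graph = group G for G (structure) +
  fixes \<Phi> :: "('v, 'e, 'a) gain_graph"
  assumes gain_graph: "is_gain_graph G \<Phi>"
    and finite_edges: "finite (edges \<Phi>)"
begin

definition ordinary :: "'e set \<Rightarrow> bool" where
  "ordinary S \<longleftrightarrow> S \<subseteq> edges \<Phi> \<and> (\<forall>e\<in>S. \<not> half \<Phi> e)"

definition links :: "'e set \<Rightarrow> ('v \<times> 'v) set" where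
  "links S = {(tail \<Phi> e, head \<Phi> e) | e. e \<in> S}"

lemma finite_verts: "finite (verts \<Phi>)"
  using gain_graph by (simp add: is_gain_graph_def)

lemma tail_in_verts: "e \<in> edges \<Phi> \<Longrightarrow> tail \<Phi> e \<in> verts \<Phi>"
  and head_in_verts: "e \<in> edges \<Phi> \<Longrightarrow> head \<Phi> e \<in> verts \<Phi>"
  and half_edge_endpoints: "e \<in> edges \<Phi> \<Longrightarrow> half \<Phi> e \<Longrightarrow> head \<Phi> e = tail \<Phi> e"
  using gain_graph by (auto simp: is_gain_graph_def)

lemma source_in_verts: "fst a \<in> edges \<Phi> \<Longrightarrow> source \<Phi> a \<in> verts \<Phi>"
  and target_in_verts: "fst a \<in> edges \<Phi> \<Longrightarrow> target \<Phi> a \<in> verts \<Phi>"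
  by (simp_all add: source_def target_def tail_in_verts head_in_verts)

lemma gain_closed: "e \<in> edges \<Phi> \<Longrightarrow> \<not> half \<Phi> e \<Longrightarrow> gain \<Phi> (e, d) \<in> carrier G"
  using gain_graph by (auto simp: is_gain_graph_def)

lemma gain_reverse: "e \<in> edges \<Phi> \<Longrightarrow> \<not> half \<Phi> e \<Longrightarrow> gain \<Phi> (e, False) = inv (gain \<Phi> (e, True))"
  using gain_graph unfolding is_gain_graph_def by (metis (full_types))

lemma edge_endpoints_connected: "e \<in> S \<Longrightarrow> (tail \<Phi> e, head \<Phi> e) \<in> connection (links S)"
  by (rule connection_base) (auto simp: links_def)

lemma links_orientedE:
  assumes "(x, y) \<in> links S \<union> (links S)\<inverse>"
  obtains a where "fst a \<in> S" "source \<Phi> a = x" "target \<Phi> a = y"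
proof -
  from assms consider (forward) e where "e \<in> S" "x = tail \<Phi> e" "y = head \<Phi> e"
    | (backward) e where "e \<in> S" "x = head \<Phi> e" "y = tail \<Phi> e"
    by (auto simp: links_def)
  then show thesis
  proof cases
    case (forward e)
    then show thesis using that[of "(e, True)"] by (simp add: source_def target_def)
  next
    case (backward e)
    then show thesis using that[of "(e, False)"] by (simp add: source_def target_def)
  qed
qed

fun walk :: "'e set \<Rightarrow> 'v \<Rightarrow> ('e \<times> bool) list \<Rightarrow> 'v \<Rightarrow> bool" where
  "walk S u [] v \<longleftrightarrow> u = v"
| "walk S u (a # p) v \<longleftrightarrow> fst a \<in> S \<and> source \<Phi> a = u \<and> walk S (target \<Phi> a) p v"

abbreviation simple_walk :: "'e set \<Rightarrow> 'v \<Rightarrow> ('e \<times> bool) list \<Rightarrow> 'v \<Rightarrow> bool" where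
  "simple_walk S u p v \<equiv> walk S u p v \<and> distinct (map (source \<Phi>) p @ [v])"

lemma walk_iff:
  "walk S u p v \<longleftrightarrow>
     (\<forall>a\<in>set p. fst a \<in> S) \<and> map (source \<Phi>) p @ [v] = u # map (target \<Phi>) p"
  by (induction p arbitrary: u) auto

lemma walk_mono: "walk S u p v \<Longrightarrow> S \<subseteq> T \<Longrightarrow> walk T u p v"
  by (auto simp: walk_iff)

lemma walk_suffix: "walk S u (p @ q) v \<Longrightarrow> \<exists>w. walk S w q v"
  by (induction p arbitrary: u) auto

lemma walk_endpoints:
  assumes "walk S u p v" "a \<in> set p"
  shows "{source \<Phi> a, target \<Phi> a} \<subseteq> set (map (source \<Phi>) p @ [v])"
proof -
  have "map (source \<Phi>) p @ [v] = u # map (target \<Phi>) p"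
    using assms(1) by (simp add: walk_iff)
  then have "target \<Phi> a \<in> set (map (source \<Phi>) p @ [v])" using assms(2) by simp
  then show ?thesis using assms(2) by simp
qed

lemma simple_walk_exists:
  assumes "(u, v) \<in> connection (links S)"
  shows "\<exists>p. simple_walk S u p v"
  using assms unfolding connection_def
proof (induction rule: converse_rtrancl_induct)
  case base
  show ?case by (intro exI[of _ "[]"]) simp
next
  case (step x y)
  then obtain p where p: "walk S y p v" "distinct (map (source \<Phi>) p @ [v])" by blast
  obtain a where a: "fst a \<in> S" "source \<Phi> a = x" "target \<Phi> a = y"
    using step.hyps(1) by (rule links_orientedE)
  consider (at_end) "x = v" | (revisited) "x \<noteq> v" "x \<in> set (map (source \<Phi>) p)"
    | (new) "x \<notin> set (map (source \<Phi>) p @ [v])"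
    by auto
  then show ?case
  proof cases
    case at_end
    then show ?thesis by (intro exI[of _ "[]"]) simp
  next
    case revisited
    then obtain b q r where b: "source \<Phi> b = x" and p_split: "p = q @ b # r"
      by (auto dest: split_list)
    then have "walk S x (b # r) v" using walk_suffix[of S y q "b # r" v] p(1) by auto
    then show ?thesis using p(2) p_split by (intro exI[of _ "b # r"]) simp
  next
    case new
    then show ?thesis using p a by (intro exI[of _ "a # p"]) auto
  qed
qed

lemma simple_walk_distinct_edges: "simple_walk S u p v \<Longrightarrow> distinct (map fst p)"
proof (induction p arbitrary: u)
  case (Cons a p)
  then have tl: "simple_walk S (target \<Phi> a) p v" by simp
  have "fst b \<noteq> fst a" if "b \<in> set p" for b
  proof
    assume "fst b = fst a"
    then have "source \<Phi> a \<in> {source \<Phi> b, target \<Phi> b}" by (auto simp: source_def target_def)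
    then have "source \<Phi> a \<in> set (map (source \<Phi>) p @ [v])"
      using walk_endpoints[OF conjunct1[OF tl] that] by blast
    then show False using Cons.prems by auto
  qed
  then have "fst a \<notin> fst ` set p" by force
  then show ?case using Cons.IH[OF tl] by simp
qed simp

lemma circle_iff_closed_walk:
  "circle \<Phi> S C \<longleftrightarrow> C \<noteq> [] \<and> (\<forall>a\<in>set C. \<not> half \<Phi> (fst a)) \<and> distinct (map fst C) \<and>
     distinct (map (source \<Phi>) C) \<and> walk S (source \<Phi> (hd C)) C (source \<Phi> (hd C))"
proof -
  have "rotate1 (map (source \<Phi>) C) ! k = source \<Phi> (C ! (Suc k mod length C))"
    if "k < length C" for k
  proof -
    have "Suc k mod length C < length C" using that by (intro mod_less_divisor) linarith
    then show ?thesis using that by (simp add: nth_rotate1)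
  qed
  then have "(\<forall>k<length C. target \<Phi> (C ! k) = source \<Phi> (C ! (Suc k mod length C))) \<longleftrightarrow>
      map (target \<Phi>) C = rotate1 (map (source \<Phi>) C)"
    by (simp add: list_eq_iff_nth_eq[of "map (target \<Phi>) C"])
  also have "\<dots> \<longleftrightarrow> map (source \<Phi>) C @ [source \<Phi> (hd C)] = source \<Phi> (hd C) # map (target \<Phi>) C"
    if "C \<noteq> []"
    using that by (cases C) auto
  finally show ?thesis by (auto simp: circle_def walk_iff)
qed

lemma circle_close_walk:
  assumes "simple_walk S (head \<Phi> e) p (tail \<Phi> e)" "e \<notin> S" "ordinary (insert e S)"
  shows "circle \<Phi> (insert e S) ((e, True) # p)"
proof -
  have in_S: "fst a \<in> S" if "a \<in> set p" for a
    using assms(1) that by (simp add: walk_iff)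
  then have "e \<notin> fst ` set p" using assms(2) by blast
  moreover have "walk (insert e S) (head \<Phi> e) p (tail \<Phi> e)"
    using assms(1) by (blast intro: walk_mono)
  ultimately show ?thesis
    using assms(1,3) in_S simple_walk_distinct_edges[OF assms(1)]
    by (auto simp: circle_iff_closed_walk ordinary_def source_def target_def)
qed

lemma walk_gain_closed: "ordinary S \<Longrightarrow> walk S u p v \<Longrightarrow> circle_gain G \<Phi> p \<in> carrier G"
proof (induction p arbitrary: u)
  case (Cons a p)
  then show ?case
    using gain_closed[of "fst a" "snd a"] by (auto simp: circle_gain_def ordinary_def)
qed (simp add: circle_gain_def)

section \<open>Improper edges\<close>

definition improper :: "('v \<Rightarrow> ('a \<times> nat) option) \<Rightarrow> 'e \<Rightarrow> bool" where
  "improper f e \<longleftrightarrow>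
     (if half \<Phi> e then f (tail \<Phi> e) = None
      else f (head \<Phi> e) = act (f (tail \<Phi> e)) (gain \<Phi> (e, True)))"

lemma improper_oriented:
  assumes f: "f \<in> verts \<Phi> \<rightarrow> colors k" and "fst a \<in> edges \<Phi>" "\<not> half \<Phi> (fst a)"
    and "improper f (fst a)"
  shows "f (target \<Phi> a) = act (f (source \<Phi> a)) (gain \<Phi> a)"
proof -
  obtain e d where a: "a = (e, d)" by (cases a)
  have g: "gain \<Phi> (e, True) \<in> carrier G" using gain_closed assms a by simp
  have col: "f (tail \<Phi> e) \<in> colors k" "f (head \<Phi> e) \<in> colors k"
    using funcset_mem[OF f] assms(2) a tail_in_verts head_in_verts by simp_all
  have h: "f (head \<Phi> e) = act (f (tail \<Phi> e)) (gain \<Phi> (e, True))"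
    using assms a by (simp add: improper_def)
  moreover have "f (tail \<Phi> e) = act (f (head \<Phi> e)) (gain \<Phi> (e, False))"
    using h g assms(2,3) a gain_reverse[of e] act_inv_eq_iff[OF col(2,1) g] by simp
  ultimately show ?thesis using a by (cases d) (simp_all add: source_def target_def)
qed

lemma improper_walk:
  assumes f: "f \<in> verts \<Phi> \<rightarrow> colors k" and S: "ordinary S" and imp: "\<And>e. e \<in> S \<Longrightarrow> improper f e"
    and "u \<in> verts \<Phi>" "walk S u p v"
  shows "f v = act (f u) (circle_gain G \<Phi> p)"
  using assms(4,5)
proof (induction p arbitrary: u)
  case Nil
  then show ?case using act_one[OF funcset_mem[OF f]] by (simp add: circle_gain_def)
next
  case (Cons a p)
  then have a: "fst a \<in> S" "source \<Phi> a = u" and p: "walk S (target \<Phi> a) p v" by auto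
  then have e: "fst a \<in> edges \<Phi>" "\<not> half \<Phi> (fst a)" using S by (auto simp: ordinary_def)
  have "f v = act (f (target \<Phi> a)) (circle_gain G \<Phi> p)"
    using Cons.IH[OF _ p] e target_in_verts by simp
  also have "\<dots> = act (act (f u) (gain \<Phi> a)) (circle_gain G \<Phi> p)"
    using improper_oriented[OF f e imp[OF a(1)]] a(2) by simp
  also have "\<dots> = act (f u) (gain \<Phi> a \<otimes> circle_gain G \<Phi> p)"
    using f Cons.prems(1) e gain_closed[of "fst a" "snd a"] walk_gain_closed[OF S p]
    by (auto intro: act_act)
  finally show ?case by (simp add: circle_gain_def)
qed

lemma improper_zero_connected:
  assumes "S \<subseteq> edges \<Phi>" "\<And>e. e \<in> S \<Longrightarrow> improper f e" "(u, v) \<in> connection (links S)"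
  shows "f u = None \<longleftrightarrow> f v = None"
proof (rule connection_invariant[OF assms(3)])
  fix x y assume "(x, y) \<in> links S"
  then obtain e where e: "e \<in> S" "x = tail \<Phi> e" "y = head \<Phi> e" by (auto simp: links_def)
  then show "f x = None \<longleftrightarrow> f y = None"
    using assms(1) assms(2)[OF e(1)] half_edge_endpoints[of e]
    by (cases "half \<Phi> e") (auto simp: improper_def)
qed

text \<open>A non-neutral circle forces a zero because \<open>G\<close> acts freely on the nonzero colors.\<close>

lemma unbalanced_improper_zero:
  assumes f: "f \<in> verts \<Phi> \<rightarrow> colors k" and S: "S \<subseteq> edges \<Phi>"
    and imp: "\<And>e. e \<in> S \<Longrightarrow> improper f e" and unbalanced: "\<not> balanced G \<Phi> S"
  shows "\<exists>e\<in>S. f (tail \<Phi> e) = None"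
proof (cases "\<exists>e\<in>S. half \<Phi> e")
  case True
  then show ?thesis using imp unfolding improper_def by metis
next
  case False
  then have ord: "ordinary S" using S by (auto simp: ordinary_def)
  obtain C where C: "circle \<Phi> S C" "circle_gain G \<Phi> C \<noteq> \<one>"
    using unbalanced False by (auto simp: balanced_def)
  let ?u = "source \<Phi> (hd C)"
  have closed: "walk S ?u C ?u" using C(1) by (simp add: circle_iff_closed_walk)
  have e: "fst (hd C) \<in> S" using C(1) by (simp add: circle_def)
  have u: "?u \<in> verts \<Phi>" using e S source_in_verts by blast
  then have "f ?u = None"
    using act_fixed_imp_None[OF funcset_mem[OF f u] walk_gain_closed[OF ord closed] C(2)]
      improper_walk[OF f ord imp u closed] by simp
  then show ?thesis
    using e improper_zero_connected[OF S imp edge_endpoints_connected[OF e]]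
    by (auto simp: source_def split: if_splits)
qed

section \<open>Potentials\<close>

definition potential :: "'e set \<Rightarrow> ('v \<Rightarrow> 'a) \<Rightarrow> bool" where
  "potential S \<theta> \<longleftrightarrow> \<theta> \<in> verts \<Phi> \<rightarrow> carrier G \<and>
     (\<forall>e\<in>S. \<theta> (head \<Phi> e) = \<theta> (tail \<Phi> e) \<otimes> gain \<Phi> (e, True))"

text \<open>A potential is an improper coloring by nonzero colors.\<close>

lemma potential_walk:
  assumes "potential S \<theta>" "ordinary S" "u \<in> verts \<Phi>" "walk S u p v"
  shows "\<theta> v = \<theta> u \<otimes> circle_gain G \<Phi> p"
proof -
  let ?f = "\<lambda>v. Some (\<theta> v, 0 :: nat)"
  have "?f v = act (?f u) (circle_gain G \<Phi> p)"
  proof (rule improper_walk[OF _ assms(2) _ assms(3,4)])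
    show "?f \<in> verts \<Phi> \<rightarrow> colors 1" using assms(1) by (auto simp: potential_def)
    show "improper ?f e" if "e \<in> S" for e
      using that assms(1,2) by (simp add: potential_def ordinary_def improper_def)
  qed
  then show ?thesis by simp
qed

lemma balanced_subset: "balanced G \<Phi> S \<Longrightarrow> T \<subseteq> S \<Longrightarrow> balanced G \<Phi> T"
  unfolding balanced_def circle_def by blast

lemma potential_insert_connected:
  assumes \<theta>: "potential S \<theta>" and "e \<notin> S" and ord: "ordinary (insert e S)"
    and balanced: "balanced G \<Phi> (insert e S)"
    and connected: "(head \<Phi> e, tail \<Phi> e) \<in> connection (links S)"
  shows "potential (insert e S) \<theta>"
proof -
  let ?g = "gain \<Phi> (e, True)"
  have ordS: "ordinary S" and e: "e \<in> edges \<Phi>" "\<not> half \<Phi> e"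
    using ord by (auto simp: ordinary_def)
  obtain p where p: "simple_walk S (head \<Phi> e) p (tail \<Phi> e)"
    using simple_walk_exists[OF connected] by blast
  let ?w = "circle_gain G \<Phi> p"
  have carr: "?g \<in> carrier G" "?w \<in> carrier G" "\<theta> (head \<Phi> e) \<in> carrier G"
    using gain_closed[OF e] walk_gain_closed[OF ordS] p \<theta> head_in_verts[OF e(1)]
    by (auto simp: potential_def)
  have "circle_gain G \<Phi> ((e, True) # p) = \<one>"
    using balanced circle_close_walk[OF p assms(2) ord] by (simp add: balanced_def)
  then have "?g \<otimes> ?w = \<one>" by (simp add: circle_gain_def)
  then have "?w \<otimes> ?g = \<one>" using carr by (simp add: inv_comm)
  moreover have "\<theta> (tail \<Phi> e) = \<theta> (head \<Phi> e) \<otimes> ?w"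
    using potential_walk[OF \<theta> ordS head_in_verts[OF e(1)]] p by blast
  ultimately have "\<theta> (head \<Phi> e) = \<theta> (tail \<Phi> e) \<otimes> ?g"
    using carr by (simp add: m_assoc)
  then show ?thesis using \<theta> by (simp add: potential_def)
qed

text \<open>Translating the potential on the component of the head accommodates a bridge.\<close>

lemma potential_insert_bridge:
  assumes \<theta>: "potential S \<theta>" and ord: "ordinary (insert e S)"
    and bridge: "(head \<Phi> e, tail \<Phi> e) \<notin> connection (links S)"
  shows "\<exists>\<eta>. potential (insert e S) \<eta>"
proof -
  let ?t = "tail \<Phi> e" and ?h = "head \<Phi> e" and ?g = "gain \<Phi> (e, True)"
  define k where "k = \<theta> ?t \<otimes> ?g \<otimes> inv (\<theta> ?h)"
  define \<eta> where "\<eta> x = (if (?h, x) \<in> connection (links S) then k \<otimes> \<theta> x else \<theta> x)" for x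
  have \<theta>_closed: "\<theta> v \<in> carrier G" if "v \<in> verts \<Phi>" for v
    using \<theta> that by (auto simp: potential_def)
  have edge: "d \<in> edges \<Phi>" "gain \<Phi> (d, True) \<in> carrier G"
    "\<theta> (tail \<Phi> d) \<in> carrier G" "\<theta> (head \<Phi> d) \<in> carrier G" if "d \<in> insert e S" for d
    using that ord gain_closed \<theta>_closed tail_in_verts head_in_verts by (auto simp: ordinary_def)
  have k: "k \<in> carrier G" using edge[of e] by (simp add: k_def)
  have "\<eta> (head \<Phi> d) = \<eta> (tail \<Phi> d) \<otimes> gain \<Phi> (d, True)" if d: "d \<in> S" for d
  proof -
    have "(?h, tail \<Phi> d) \<in> connection (links S) \<longleftrightarrow> (?h, head \<Phi> d) \<in> connection (links S)"
      using edge_endpoints_connected[OF d] by (meson connection_sym connection_trans)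
    then show ?thesis
      using \<theta> d k edge[of d] by (simp add: \<eta>_def m_assoc potential_def)
  qed
  moreover have "\<eta> ?h = \<eta> ?t \<otimes> ?g"
    using bridge edge[of e] by (simp add: \<eta>_def k_def m_assoc)
  moreover have "\<eta> \<in> verts \<Phi> \<rightarrow> carrier G" using \<theta>_closed k by (simp add: \<eta>_def)
  ultimately show ?thesis by (auto simp: potential_def)
qed

lemma balanced_imp_potential:
  assumes "S \<subseteq> edges \<Phi>" "balanced G \<Phi> S"
  shows "\<exists>\<theta>. potential S \<theta>"
  using finite_subset[OF assms(1) finite_edges] assms
proof (induction S)
  case empty
  show ?case by (intro exI[of _ "\<lambda>_. \<one>"]) (simp add: potential_def)
next
  case (insert e S)
  have ord: "ordinary (insert e S)"
    using insert.prems by (auto simp: ordinary_def balanced_def)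
  obtain \<theta> where \<theta>: "potential S \<theta>"
    using insert.IH insert.prems balanced_subset[OF insert.prems(2), of S] by blast
  show ?case
  proof (cases "(head \<Phi> e, tail \<Phi> e) \<in> connection (links S)")
    case True
    then show ?thesis
      using potential_insert_connected[OF \<theta> insert.hyps(2) ord insert.prems(2)] by blast
  next
    case False
    then show ?thesis by (rule potential_insert_bridge[OF \<theta> ord])
  qed
qed

section \<open>Balanced components and switching\<close>

definition component_of :: "'e set \<Rightarrow> 'v \<Rightarrow> 'v set" where
  "component_of S v = connection_on (verts \<Phi>) (links S) `` {v}"

definition edges_within :: "'e set \<Rightarrow> 'v set \<Rightarrow> 'e set" where
  "edges_within S B = {e \<in> S. tail \<Phi> e \<in> B \<and> head \<Phi> e \<in> B}"

definition balanced_components :: "'e set \<Rightarrow> 'v set set" where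
  "balanced_components S = {B \<in> components \<Phi> S. balanced G \<Phi> (edges_within S B)}"

definition balanced_part :: "'e set \<Rightarrow> 'e set" where
  "balanced_part S = {e \<in> S. component_of S (tail \<Phi> e) \<in> balanced_components S}"

lemma components_eq_quotient: "components \<Phi> S = verts \<Phi> // connection_on (verts \<Phi>) (links S)"
  by (simp add: components_def links_def conn_classes_eq_quotient)

lemma balanced_count_eq_card: "balanced_count G \<Phi> S = card (balanced_components S)"
  by (simp add: balanced_count_def balanced_components_def edges_within_def)

lemma component_of_in_components: "v \<in> verts \<Phi> \<Longrightarrow> component_of S v \<in> components \<Phi> S"
  by (simp add: component_of_def components_eq_quotient quotientI)

lemma component_of_self: "v \<in> verts \<Phi> \<Longrightarrow> v \<in> component_of S v"
  by (simp add: component_of_def connection_on_def)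

lemma mem_component_of: "u \<in> component_of S v \<Longrightarrow> (u, v) \<in> connection (links S)"
  by (auto simp: component_of_def connection_on_def intro: connection_sym)

lemma component_of_endpoints:
  assumes "e \<in> S" "S \<subseteq> edges \<Phi>"
  shows "component_of S (tail \<Phi> e) = component_of S (head \<Phi> e)"
proof -
  have "(tail \<Phi> e, head \<Phi> e) \<in> connection_on (verts \<Phi>) (links S)"
    using assms edge_endpoints_connected[of e S] tail_in_verts head_in_verts
    by (auto simp: connection_on_def)
  then show ?thesis
    unfolding component_of_def by (rule equiv_class_eq[OF equiv_connection_on])
qed

lemma edges_within_component_of:
  assumes "e \<in> S" "S \<subseteq> edges \<Phi>"
  shows "e \<in> edges_within S (component_of S (tail \<Phi> e))"
  using assms component_of_endpoints[OF assms] component_of_self[of "tail \<Phi> e" S]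
    component_of_self[of "head \<Phi> e" S] tail_in_verts[of e] head_in_verts[of e]
  by (auto simp: edges_within_def)

lemma balanced_part_not_half:
  "S \<subseteq> edges \<Phi> \<Longrightarrow> e \<in> balanced_part S \<Longrightarrow> \<not> half \<Phi> e"
  using edges_within_component_of[of e S]
  by (auto simp: balanced_part_def balanced_components_def balanced_def)

lemma ex_potential_balanced_part:
  assumes S: "S \<subseteq> edges \<Phi>"
  shows "\<exists>\<theta>. potential (balanced_part S) \<theta>"
proof -
  have "\<forall>B\<in>balanced_components S. \<exists>\<theta>. potential (edges_within S B) \<theta>"
    using S by (auto simp: balanced_components_def edges_within_def intro!: balanced_imp_potential)
  then obtain \<Theta> where \<Theta>: "\<And>B. B \<in> balanced_components S \<Longrightarrow> potential (edges_within S B) (\<Theta> B)"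
    by (metis bchoice)
  define \<theta> where "\<theta> v =
    (if component_of S v \<in> balanced_components S then \<Theta> (component_of S v) v else \<one>)" for v
  have "\<theta> \<in> verts \<Phi> \<rightarrow> carrier G" using \<Theta> by (fastforce simp: \<theta>_def potential_def)
  moreover have "\<theta> (head \<Phi> e) = \<theta> (tail \<Phi> e) \<otimes> gain \<Phi> (e, True)" if e: "e \<in> balanced_part S" for e
  proof -
    let ?B = "component_of S (tail \<Phi> e)"
    have "e \<in> S" "?B \<in> balanced_components S" using e by (auto simp: balanced_part_def)
    moreover have "component_of S (head \<Phi> e) = ?B" "e \<in> edges_within S ?B"
      using component_of_endpoints edges_within_component_of S \<open>e \<in> S\<close> by simp_all
    ultimately show ?thesis using \<Theta>[of ?B] by (simp add: \<theta>_def potential_def)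
  qed
  ultimately show ?thesis by (auto simp: potential_def)
qed

definition switch :: "('v \<Rightarrow> 'a) \<Rightarrow> ('v \<Rightarrow> ('a \<times> nat) option) \<Rightarrow> 'v \<Rightarrow> ('a \<times> nat) option" where
  "switch \<theta> f = (\<lambda>v\<in>verts \<Phi>. act (f v) (inv (\<theta> v)))"

lemma bij_betw_switch:
  assumes \<theta>: "\<theta> \<in> verts \<Phi> \<rightarrow> carrier G"
  shows "bij_betw (switch \<theta>) (verts \<Phi> \<rightarrow>\<^sub>E colors k) (verts \<Phi> \<rightarrow>\<^sub>E colors k)"
proof (rule bij_betw_byWitness[where f' = "\<lambda>f. \<lambda>v\<in>verts \<Phi>. act (f v) (\<theta> v)"])
  let ?C = "verts \<Phi> \<rightarrow>\<^sub>E colors k"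
  have \<theta>v: "\<theta> v \<in> carrier G" if "v \<in> verts \<Phi>" for v using \<theta> that by auto
  have cancel: "act (act x (inv (\<theta> v))) (\<theta> v) = x" "act (act x (\<theta> v)) (inv (\<theta> v)) = x"
    if "v \<in> verts \<Phi>" "x \<in> colors k" for v x
    using that \<theta>v by (simp_all add: act_act act_one)
  show "\<forall>f\<in>?C. (\<lambda>v\<in>verts \<Phi>. act (switch \<theta> f v) (\<theta> v)) = f"
    using cancel(1) by (auto simp: switch_def PiE_iff extensional_def fun_eq_iff)
  show "\<forall>f\<in>?C. switch \<theta> (\<lambda>v\<in>verts \<Phi>. act (f v) (\<theta> v)) = f"
    using cancel(2) by (auto simp: switch_def PiE_iff extensional_def fun_eq_iff)
  show "switch \<theta> ` ?C \<subseteq> ?C" "(\<lambda>f. \<lambda>v\<in>verts \<Phi>. act (f v) (\<theta> v)) ` ?C \<subseteq> ?C"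
    using \<theta>v by (auto simp: switch_def PiE_iff intro!: act_closed)
qed

lemma improper_iff_switch_eq:
  assumes f: "f \<in> verts \<Phi> \<rightarrow> colors k" and e: "e \<in> edges \<Phi>" "\<not> half \<Phi> e"
    and \<theta>: "\<theta> \<in> verts \<Phi> \<rightarrow> carrier G" "\<theta> (head \<Phi> e) = \<theta> (tail \<Phi> e) \<otimes> gain \<Phi> (e, True)"
  shows "improper f e \<longleftrightarrow> switch \<theta> f (tail \<Phi> e) = switch \<theta> f (head \<Phi> e)"
proof -
  let ?t = "tail \<Phi> e" and ?h = "head \<Phi> e" and ?g = "gain \<Phi> (e, True)"
  have V: "?t \<in> verts \<Phi>" "?h \<in> verts \<Phi>" using e tail_in_verts head_in_verts by auto
  have carr: "\<theta> ?t \<in> carrier G" "\<theta> ?h \<in> carrier G" "?g \<in> carrier G"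
    using \<theta>(1) V gain_closed[OF e] by auto
  have col: "f ?t \<in> colors k" "f ?h \<in> colors k" using f V by auto
  have "switch \<theta> f ?t = switch \<theta> f ?h \<longleftrightarrow> act (f ?h) (inv (\<theta> ?h)) = act (f ?t) (inv (\<theta> ?t))"
    using V by (auto simp: switch_def)
  also have "\<dots> \<longleftrightarrow> f ?h = act (act (f ?t) (inv (\<theta> ?t))) (\<theta> ?h)"
    using carr col by (intro act_inv_eq_iff act_closed) auto
  also have "act (act (f ?t) (inv (\<theta> ?t))) (\<theta> ?h) = act (f ?t) ?g"
    using carr col by (simp add: act_act \<theta>(2) flip: m_assoc)
  finally show ?thesis using e(2) by (simp add: improper_def)
qed

lemma zero_on_unbalanced_component:
  assumes f: "f \<in> verts \<Phi> \<rightarrow> colors k" and S: "S \<subseteq> edges \<Phi>"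
    and imp: "\<And>e. e \<in> S \<Longrightarrow> improper f e"
    and v: "v \<in> verts \<Phi>" "component_of S v \<notin> balanced_components S"
  shows "f v = None"
proof -
  let ?T = "edges_within S (component_of S v)"
  have "\<not> balanced G \<Phi> ?T"
    using v component_of_in_components by (simp add: balanced_components_def)
  then obtain e where e: "e \<in> ?T" "f (tail \<Phi> e) = None"
    using unbalanced_improper_zero[OF f, of ?T] S imp by (auto simp: edges_within_def)
  then have "(tail \<Phi> e, v) \<in> connection (links S)"
    by (intro mem_component_of) (simp add: edges_within_def)
  then show ?thesis using improper_zero_connected[OF S imp] e(2) by blast
qed

lemma improper_iff_switch_eq_if_zero:
  assumes f: "f \<in> verts \<Phi> \<rightarrow> colors k" and S: "S \<subseteq> edges \<Phi>"
    and \<theta>: "potential (balanced_part S) \<theta>"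
    and zero: "\<And>v. v \<in> verts \<Phi> \<Longrightarrow> component_of S v \<notin> balanced_components S \<Longrightarrow> f v = None"
    and e: "e \<in> S"
  shows "improper f e \<longleftrightarrow> switch \<theta> f (tail \<Phi> e) = switch \<theta> f (head \<Phi> e)"
proof (cases "e \<in> balanced_part S")
  case True
  then show ?thesis
    using \<theta> S e balanced_part_not_half[OF S True]
    by (intro improper_iff_switch_eq[OF f]) (auto simp: potential_def)
next
  case False
  have V: "tail \<Phi> e \<in> verts \<Phi>" "head \<Phi> e \<in> verts \<Phi>"
    using e S tail_in_verts head_in_verts by auto
  then have "f (tail \<Phi> e) = None" "f (head \<Phi> e) = None"
    using False e component_of_endpoints[OF e S] by (auto simp: balanced_part_def intro!: zero)
  then show ?thesis using V by (simp add: improper_def switch_def)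
qed

lemma connection_on_invariant_iff:
  assumes "S \<subseteq> edges \<Phi>"
  shows "(\<forall>x y. (x, y) \<in> connection_on (verts \<Phi>) (links S) \<longrightarrow> h x = h y) \<longleftrightarrow>
    (\<forall>e\<in>S. h (tail \<Phi> e) = h (head \<Phi> e))"
proof (intro iffI ballI allI impI)
  fix e assume "\<forall>x y. (x, y) \<in> connection_on (verts \<Phi>) (links S) \<longrightarrow> h x = h y" and "e \<in> S"
  then show "h (tail \<Phi> e) = h (head \<Phi> e)"
    using assms edge_endpoints_connected[of e S] tail_in_verts[of e] head_in_verts[of e]
    by (auto simp: connection_on_def)
next
  fix x y assume "\<forall>e\<in>S. h (tail \<Phi> e) = h (head \<Phi> e)"
    and "(x, y) \<in> connection_on (verts \<Phi>) (links S)"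
  then show "h x = h y"
    by (intro connection_invariant[of x y "links S"]) (auto simp: connection_on_def links_def)
qed

lemma all_improper_iff_switch_class_function:
  assumes f: "f \<in> verts \<Phi> \<rightarrow>\<^sub>E colors k" and S: "S \<subseteq> edges \<Phi>"
    and \<theta>: "potential (balanced_part S) \<theta>"
  shows "(\<forall>e\<in>S. improper f e) \<longleftrightarrow>
    switch \<theta> f \<in> class_functions (verts \<Phi>) (colors k) (connection_on (verts \<Phi>) (links S))
      (balanced_components S) None" (is "_ \<longleftrightarrow> _ \<in> ?F")
proof -
  let ?zero = "\<forall>v\<in>verts \<Phi>. component_of S v \<notin> balanced_components S \<longrightarrow> f v = None"
  have fcol: "f \<in> verts \<Phi> \<rightarrow> colors k" and \<theta>V: "\<theta> \<in> verts \<Phi> \<rightarrow> carrier G"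
    using f \<theta> by (auto simp: potential_def)
  have "(\<forall>e\<in>S. improper f e) \<longleftrightarrow> ?zero \<and> (\<forall>e\<in>S. improper f e)"
    using zero_on_unbalanced_component[OF fcol S] by blast
  also have "\<dots> \<longleftrightarrow> ?zero \<and> (\<forall>e\<in>S. switch \<theta> f (tail \<Phi> e) = switch \<theta> f (head \<Phi> e))"
    using improper_iff_switch_eq_if_zero[OF fcol S \<theta>] by blast
  also have "\<dots> \<longleftrightarrow> ?zero \<and>
      (\<forall>x y. (x, y) \<in> connection_on (verts \<Phi>) (links S) \<longrightarrow> switch \<theta> f x = switch \<theta> f y)"
    by (simp only: connection_on_invariant_iff[OF S])
  also have "\<dots> \<longleftrightarrow> switch \<theta> f \<in> ?F"
    using bij_betwE[OF bij_betw_switch[OF \<theta>V]] f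
    by (auto simp: class_functions_def component_of_def switch_def)
  finally show ?thesis .
qed

lemma card_improper_colorings:
  assumes S: "S \<subseteq> edges \<Phi>"
  shows "card {f \<in> verts \<Phi> \<rightarrow>\<^sub>E colors k. \<forall>e\<in>S. improper f e} =
    card (colors k) ^ balanced_count G \<Phi> S"
proof -
  obtain \<theta> where \<theta>: "potential (balanced_part S) \<theta>"
    using ex_potential_balanced_part[OF S] by blast
  then have \<theta>V: "\<theta> \<in> verts \<Phi> \<rightarrow> carrier G" by (simp add: potential_def)
  let ?F = "class_functions (verts \<Phi>) (colors k) (connection_on (verts \<Phi>) (links S))
    (balanced_components S) None"
  have "bij_betw (switch \<theta>) {f \<in> verts \<Phi> \<rightarrow>\<^sub>E colors k. \<forall>e\<in>S. improper f e}
      {h \<in> verts \<Phi> \<rightarrow>\<^sub>E colors k. h \<in> ?F}"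
    by (rule bij_betw_Collect[OF bij_betw_switch[OF \<theta>V]])
      (simp add: all_improper_iff_switch_class_function[OF _ S \<theta>])
  also have "{h \<in> verts \<Phi> \<rightarrow>\<^sub>E colors k. h \<in> ?F} = ?F" by (auto simp: class_functions_def)
  finally have "card {f \<in> verts \<Phi> \<rightarrow>\<^sub>E colors k. \<forall>e\<in>S. improper f e} = card ?F"
    by (rule bij_betw_same_card)
  also have "\<dots> = card (colors k) ^ balanced_count G \<Phi> S"
    unfolding balanced_count_eq_card
    by (rule card_class_functions[OF equiv_connection_on finite_verts])
      (auto simp: balanced_components_def components_eq_quotient)
  finally show ?thesis .
qed

definition proper_gain_colorings :: "nat \<Rightarrow> ('v \<Rightarrow> ('a \<times> nat) option) set" where
  "proper_gain_colorings k = {f \<in> verts \<Phi> \<rightarrow>\<^sub>E colors k. \<forall>e\<in>edges \<Phi>. \<not> improper f e}"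

lemma poly_gain_chromatic_poly:
  assumes fin: "finite (carrier G)"
  shows "poly (gain_chromatic_poly G \<Phi>) (1 + int (order G) * int k) =
    int (card (proper_gain_colorings k))"
proof -
  let ?C = "verts \<Phi> \<rightarrow>\<^sub>E colors k"
  have "poly (gain_chromatic_poly G \<Phi>) (1 + int (order G) * int k)
      = (\<Sum>S\<in>Pow (edges \<Phi>). (- 1) ^ card S * int (card {f \<in> ?C. \<forall>e\<in>S. improper f e}))"
    unfolding gain_chromatic_poly_def poly_sum
    by (intro sum.cong) (simp_all add: poly_monom card_improper_colorings card_colors[OF fin])
  also have "\<dots> = int (card {f \<in> ?C. \<forall>e\<in>edges \<Phi>. \<not> improper f e})"
    using int_card_avoiding_all[OF finite_edges, of ?C "\<lambda>e f. improper f e"]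
      finite_PiE[OF finite_verts, of "\<lambda>_. colors k"] finite_colors[OF fin] by simp
  finally show ?thesis by (simp add: proper_gain_colorings_def)
qed

end

section \<open>The full expansion\<close>

lemma mem_proper_colorings_iff_oriented:
  assumes sg: "simple_graph V E" and ori: "orients ori E"
  shows "c \<in> proper_colorings V E k \<longleftrightarrow>
    c \<in> V \<rightarrow>\<^sub>E {..<k} \<and> (\<forall>e\<in>E. c (fst (ori e)) \<noteq> c (snd (ori e)))"
proof -
  have "(\<forall>u\<in>V. \<forall>v\<in>V. {u, v} \<in> E \<longrightarrow> c u \<noteq> c v) \<longleftrightarrow> (\<forall>e\<in>E. c (fst (ori e)) \<noteq> c (snd (ori e)))"
  proof (intro iffI ballI impI)
    fix e assume all: "\<forall>u\<in>V. \<forall>v\<in>V. {u, v} \<in> E \<longrightarrow> c u \<noteq> c v" and e: "e \<in> E"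
    then have "{fst (ori e), snd (ori e)} = e" using ori by (simp add: orients_def)
    moreover from this have "fst (ori e) \<in> V" "snd (ori e) \<in> V"
      using sg e by (auto simp: simple_graph_def)
    ultimately show "c (fst (ori e)) \<noteq> c (snd (ori e))" using all e by simp
  next
    fix u v assume all: "\<forall>e\<in>E. c (fst (ori e)) \<noteq> c (snd (ori e))" and uv: "{u, v} \<in> E"
    then have "{fst (ori {u, v}), snd (ori {u, v})} = {u, v}" using ori by (simp add: orients_def)
    then show "c u \<noteq> c v" using bspec[OF all uv] by (auto simp: doubleton_eq_iff)
  qed
  then show ?thesis by (simp add: proper_colorings_def)
qed

locale oriented_simple_graph_expansion = group G for G (structure) +
  fixes V :: "'v set" and E :: "'v set set" and ori :: "'v set \<Rightarrow> 'v \<times> 'v"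
  assumes simple_graph: "simple_graph V E" and orients: "orients ori E"
    and finite_group: "finite (carrier G)"
begin

abbreviation expansion_graph :: "('v, ('a \<times> 'v set) + 'v, 'a) gain_graph" where
  "expansion_graph \<equiv> full_expansion G V E ori"

lemma finite_V: "finite V"
  using simple_graph by (simp add: simple_graph_def)

sublocale finite_gain_graph G expansion_graph
proof
  show "is_gain_graph G expansion_graph"
    using is_gain_graph_expansion[OF is_group simple_graph orients] by simp
  show "finite (edges expansion_graph)"
    using finite_V finite_group simple_graph_finite_edges[OF simple_graph]
    by (simp add: expansion_def)
qed

lemma verts_expansion [simp]: "verts expansion_graph = V"
  and edges_expansion: "edges expansion_graph = Inl ` (carrier G \<times> E) \<union> Inr ` V"
  by (simp_all add: expansion_def)

lemma improper_Inr_iff: "improper f (Inr v) \<longleftrightarrow> f v = None"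
  and improper_Inl_iff: "improper f (Inl (g, e)) \<longleftrightarrow> f (snd (ori e)) = act (f (fst (ori e))) g"
  by (simp_all add: improper_def) (simp_all add: expansion_def)

lemma proper_gain_colorings_nonzero:
  assumes f: "f \<in> proper_gain_colorings k"
  shows "f \<in> V \<rightarrow>\<^sub>E Some ` (carrier G \<times> {..<k})"
proof -
  have fcol: "f \<in> V \<rightarrow>\<^sub>E colors k" using f by (simp add: proper_gain_colorings_def)
  have "f v \<in> Some ` (carrier G \<times> {..<k})" if v: "v \<in> V" for v
  proof -
    have "\<not> improper f (Inr v)"
      using f v by (simp add: proper_gain_colorings_def edges_expansion)
    moreover have "f v \<in> colors k" using fcol v by auto
    ultimately show ?thesis by (auto simp: improper_Inr_iff colors_def)
  qed
  then show ?thesis using fcol by (auto simp: PiE_iff)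
qed

lemma pair_mem_proper_gain_colorings_iff:
  assumes h: "h \<in> V \<rightarrow>\<^sub>E carrier G" and c: "c \<in> V \<rightarrow>\<^sub>E {..<k}"
  shows "(\<lambda>v\<in>V. Some (h v, c v)) \<in> proper_gain_colorings k \<longleftrightarrow> c \<in> proper_colorings V E k"
proof -
  let ?f = "\<lambda>v\<in>V. Some (h v, c v)"
  have edge: "(\<forall>g\<in>carrier G. \<not> improper ?f (Inl (g, e))) \<longleftrightarrow> c (fst (ori e)) \<noteq> c (snd (ori e))"
    if e: "e \<in> E" for e
  proof -
    have "{fst (ori e), snd (ori e)} = e" using orients e by (simp add: orients_def)
    then have "fst (ori e) \<in> V" "snd (ori e) \<in> V"
      using simple_graph e by (auto simp: simple_graph_def)
    then have ends: "?f (fst (ori e)) = Some (h (fst (ori e)), c (fst (ori e)))"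
      "?f (snd (ori e)) = Some (h (snd (ori e)), c (snd (ori e)))"
      "h (fst (ori e)) \<in> carrier G" "h (snd (ori e)) \<in> carrier G"
      using h by auto
    then show ?thesis
      unfolding improper_Inl_iff ends(1,2) using ex_act_Some_iff[OF ends(3,4)] by blast
  qed
  have "?f \<in> V \<rightarrow>\<^sub>E colors k" using h c by auto
  then have "?f \<in> proper_gain_colorings k \<longleftrightarrow>
      (\<forall>e\<in>E. \<forall>g\<in>carrier G. \<not> improper ?f (Inl (g, e))) \<and> (\<forall>v\<in>V. \<not> improper ?f (Inr v))"
    by (auto simp: proper_gain_colorings_def edges_expansion)
  also have "\<dots> \<longleftrightarrow> c \<in> proper_colorings V E k"
    using c edge mem_proper_colorings_iff_oriented[OF simple_graph orients]
    by (simp add: improper_Inr_iff)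
  finally show ?thesis .
qed

lemma card_proper_gain_colorings:
  "card (proper_gain_colorings k) = order G ^ card V * card (proper_colorings V E k)"
proof -
  let ?pair = "\<lambda>(h, c). \<lambda>v\<in>V. Some (h v, c v)"
  let ?Q = "{x \<in> (V \<rightarrow>\<^sub>E carrier G) \<times> (V \<rightarrow>\<^sub>E {..<k}). snd x \<in> proper_colorings V E k}"
  have "bij_betw ?pair ?Q
      {f \<in> V \<rightarrow>\<^sub>E Some ` (carrier G \<times> {..<k}). f \<in> proper_gain_colorings k}"
    using pair_mem_proper_gain_colorings_iff
    by (intro bij_betw_Collect[OF bij_betw_PiE_Some_Pair]) auto
  also have "{f \<in> V \<rightarrow>\<^sub>E Some ` (carrier G \<times> {..<k}). f \<in> proper_gain_colorings k} =
      proper_gain_colorings k"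
    using proper_gain_colorings_nonzero by blast
  also have "?Q = (V \<rightarrow>\<^sub>E carrier G) \<times> proper_colorings V E k"
    by (auto simp: proper_colorings_def)
  finally show ?thesis
    using finite_V by (simp add: bij_betw_same_card[symmetric] card_cartesian_product card_PiE
        order_def)
qed

lemma pcompose_gain_chromatic_poly_expansion:
  "pcompose (gain_chromatic_poly G expansion_graph) [:1, int (order G):] =
    smult (int (order G) ^ card V) (graph_chromatic_poly V E)"
proof (rule int_poly_eqI_nat)
  fix k
  have "poly (pcompose (gain_chromatic_poly G expansion_graph) [:1, int (order G):]) (int k) =
      poly (gain_chromatic_poly G expansion_graph) (1 + int (order G) * int k)"
    by (simp add: poly_pcompose mult.commute)
  also have "\<dots> = int (order G) ^ card V * int (card (proper_colorings V E k))"
    by (simp add: poly_gain_chromatic_poly[OF finite_group] card_proper_gain_colorings)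
  finally show "poly (pcompose (gain_chromatic_poly G expansion_graph) [:1, int (order G):]) (int k) =
      poly (smult (int (order G) ^ card V) (graph_chromatic_poly V E)) (int k)"
    by (simp add: poly_graph_chromatic_poly[OF simple_graph])
qed

end

text \<open>After the substitution \<open>\<lambda> \<mapsto> \<gamma>\<lambda> - 1\<close> both sides are \<open>\<gamma>^n\<close> times the signless chromatic
  polynomial of the graph.\<close>

lemma signless_full_expansion:
  assumes sg: "simple_graph V E" and "orients ori E" and "group G"
    and "finite (carrier G)" and pos: "Coset.order G > 0"
  shows "signless_poly (card V) (gain_chromatic_poly G (full_expansion G V E ori)) =
    (\<Sum>j\<le>card V. smult (graph_whitney V E j * int (Coset.order G) ^ j) ([:1, 1:] ^ (card V - j)))"
    (is "?L = ?R")
proof -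
  let ?n = "card V" and ?\<gamma> = "int (Coset.order G)"
  interpret group G by fact
  interpret oriented_simple_graph_expansion G V E ori by unfold_locales fact+
  let ?W = "smult (?\<gamma> ^ ?n) (signless_poly ?n (graph_chromatic_poly V E))"
  have reflect: "pcompose [:0, - 1:] [:- 1, ?\<gamma>:] = pcompose [:1, ?\<gamma>:] [:0, - 1:]"
    by (simp add: pcompose_pCons)
  have "pcompose ?L [:- 1, ?\<gamma>:] = smult ((- 1) ^ ?n)
      (pcompose (pcompose (gain_chromatic_poly G expansion_graph) [:1, ?\<gamma>:]) [:0, - 1:])"
    by (simp only: signless_poly_def pcompose_smult pcompose_assoc[symmetric] reflect)
  also have "\<dots> = ?W"
    by (simp add: pcompose_gain_chromatic_poly_expansion signless_poly_def pcompose_smult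
        mult.commute)
  also have "\<dots> = (\<Sum>j\<le>?n. monom (?\<gamma> ^ ?n * graph_whitney V E j) (?n - j))"
    by (simp add: signless_graph_chromatic_poly[OF sg] smult_sum_right smult_monom)
  also have "\<dots> = pcompose ?R [:- 1, ?\<gamma>:]"
    unfolding pcompose_sum
  proof (rule sum.cong)
    fix j assume "j \<in> {..?n}"
    then have "?\<gamma> ^ ?n = ?\<gamma> ^ j * ?\<gamma> ^ (?n - j)" by (simp flip: power_add)
    moreover have "pcompose [:1, 1:] [:- 1, ?\<gamma>:] = monom ?\<gamma> 1"
      by (simp add: pcompose_pCons monom_altdef)
    ultimately show "monom (?\<gamma> ^ ?n * graph_whitney V E j) (?n - j) =
        pcompose (smult (graph_whitney V E j * ?\<gamma> ^ j) ([:1, 1:] ^ (?n - j))) [:- 1, ?\<gamma>:]"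
      by (simp add: pcompose_smult pcompose_power monom_power smult_monom mult.commute
          mult.left_commute)
  qed simp
  finally show ?thesis using pos by (simp add: pcompose_linear_cancel)
qed

lemma gain_whitney_full_expansion:
  assumes "simple_graph V E" "orients ori E" "group G" "finite (carrier G)" "Coset.order G > 0"
    and i: "i \<le> card V"
  shows "gain_whitney G (full_expansion G V E ori) i =
    (\<Sum>j = 0..i. graph_whitney V E j * int ((card V - j) choose (i - j)) * int (Coset.order G) ^ j)"
proof -
  let ?n = "card V" and ?\<gamma> = "int (Coset.order G)"
  have "verts (full_expansion G V E ori) = V" by (simp add: expansion_def)
  then have "gain_whitney G (full_expansion G V E ori) i =
      (\<Sum>j\<le>?n. graph_whitney V E j * ?\<gamma> ^ j * int ((?n - j) choose (?n - i)))"
    by (simp add: gain_whitney_def signless_full_expansion[OF assms(1-5)] coeff_sum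
        coeff_one_plus_X_power)
  also have "\<dots> = (\<Sum>j = 0..i. graph_whitney V E j * ?\<gamma> ^ j * int ((?n - j) choose (?n - i)))"
    using i by (intro sum.mono_neutral_right) (auto intro: binomial_eq_0)
  also have "\<dots> = (\<Sum>j = 0..i. graph_whitney V E j * int ((?n - j) choose (i - j)) * ?\<gamma> ^ j)"
  proof (rule sum.cong)
    fix j assume "j \<in> {0..i}"
    then have "(?n - j) choose (?n - i) = (?n - j) choose (i - j)"
      using i by (subst binomial_symmetric) auto
    then show "graph_whitney V E j * ?\<gamma> ^ j * int ((?n - j) choose (?n - i)) =
        graph_whitney V E j * int ((?n - j) choose (i - j)) * ?\<gamma> ^ j" by simp
  qed simp
  finally show ?thesis .
qed

section \<open>Deletion and contraction\<close>

definition adjacency :: "'v set set \<Rightarrow> ('v \<times> 'v) set" where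
  "adjacency E = {(u, v). {u, v} \<in> E}"

definition merge :: "'v \<Rightarrow> 'v \<Rightarrow> 'v \<Rightarrow> 'v" where
  "merge u v = (\<lambda>x. if x = v then u else x)"

definition contract :: "'v \<Rightarrow> 'v \<Rightarrow> 'v set set \<Rightarrow> 'v set set" where
  "contract u v E = (`) (merge u v) ` (E - {{u, v}})"

definition graph_rank :: "'v set \<Rightarrow> 'v set set \<Rightarrow> nat" where
  "graph_rank V E = card V - card (graph_components V E)"

lemma simple_graph_finite_verts: "simple_graph V E \<Longrightarrow> finite V"
  by (simp add: simple_graph_def)

lemma simple_graph_edge_endpoints:
  "simple_graph V E \<Longrightarrow> {u, v} \<in> E \<Longrightarrow> u \<in> V \<and> v \<in> V \<and> u \<noteq> v"
  by (auto simp: simple_graph_def)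

lemma simple_graph_delete: "simple_graph V E \<Longrightarrow> simple_graph V (E - D)"
  by (auto simp: simple_graph_def)

lemma merge_image: "u \<in> V \<Longrightarrow> v \<in> V \<Longrightarrow> u \<noteq> v \<Longrightarrow> merge u v ` V = V - {v}"
  by (auto simp: merge_def image_iff)

lemma merge_eq_iff: "merge u v x = merge u v y \<longleftrightarrow> x = y \<or> {x, y} \<subseteq> {u, v}"
  by (auto simp: merge_def)

lemma simple_graph_contract:
  assumes sg: "simple_graph V E" and e: "{u, v} \<in> E"
  shows "simple_graph (V - {v}) (contract u v E)"
proof -
  have uv: "u \<in> V" "v \<in> V" "u \<noteq> v" using simple_graph_edge_endpoints[OF sg e] by auto
  have "merge u v ` d \<subseteq> V - {v} \<and> card (merge u v ` d) = 2" if d: "d \<in> E - {{u, v}}" for d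
  proof -
    have "d \<subseteq> V" and "card d = 2" using sg d by (auto simp: simple_graph_def)
    then obtain a b where ab: "d = {a, b}" "a \<noteq> b" by (auto simp: card_2_iff)
    then have "merge u v a \<noteq> merge u v b" using d by (auto simp: merge_eq_iff)
    then have "card (merge u v ` d) = 2" by (simp add: ab(1))
    moreover have "merge u v ` d \<subseteq> V - {v}"
      using image_mono[OF \<open>d \<subseteq> V\<close>] merge_image[OF uv] by metis
    ultimately show ?thesis by blast
  qed
  then show ?thesis using sg by (auto simp: simple_graph_def contract_def)
qed

lemma delete_contract_induct [consumes 1, case_names empty edge]:
  assumes "simple_graph V E"
    and empty: "\<And>V. finite V \<Longrightarrow> P V {}"
    and edge: "\<And>V E u v. simple_graph V E \<Longrightarrow> {u, v} \<in> E \<Longrightarrow> P V (E - {{u, v}}) \<Longrightarrow>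
      P (V - {v}) (contract u v E) \<Longrightarrow> P V E"
  shows "P V E"
  using assms(1)
proof (induction "card E" arbitrary: V E rule: less_induct)
  case less
  note sg = less.prems
  show ?case
  proof (cases "E = {}")
    case True
    then show ?thesis using empty sg by (simp add: simple_graph_finite_verts)
  next
    case False
    then obtain u v where e: "{u, v} \<in> E"
      using sg by (metis all_not_in_conv card_2_iff simple_graph_def)
    have "finite E" using simple_graph_finite_edges[OF sg] .
    then have "card (E - {{u, v}}) < card E" using e by (intro psubset_card_mono) auto
    moreover have "card (contract u v E) \<le> card (E - {{u, v}})"
      using \<open>finite E\<close> by (simp add: contract_def card_image_le)
    ultimately show ?thesis
      using simple_graph_delete[OF sg] simple_graph_contract[OF sg e]
      by (intro edge[OF sg e] less.hyps) auto
  qed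
qed

lemma proper_colorings_iff_delete:
  assumes sg: "simple_graph V E" and e: "{u, v} \<in> E"
  shows "f \<in> proper_colorings V E k \<longleftrightarrow> f \<in> proper_colorings V (E - {{u, v}}) k \<and> f u \<noteq> f v"
  using simple_graph_edge_endpoints[OF sg e] e
  unfolding proper_colorings_def by (auto simp: doubleton_eq_iff) metis+

lemma card_proper_colorings_delete_contract:
  assumes sg: "simple_graph V E" and e: "{u, v} \<in> E"
  shows "card (proper_colorings V (E - {{u, v}}) k) =
    card (proper_colorings V E k) + card (proper_colorings (V - {v}) (contract u v E) k)"
proof -
  let ?D = "proper_colorings V (E - {{u, v}}) k"
  have "?D = proper_colorings V E k \<union> {f \<in> ?D. f u = f v}"
    and "proper_colorings V E k \<inter> {f \<in> ?D. f u = f v} = {}"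
    using proper_colorings_iff_delete[OF sg e] by blast+
  then have "card ?D = card (proper_colorings V E k) + card {f \<in> ?D. f u = f v}"
    using finite_proper_colorings[OF simple_graph_finite_verts[OF sg]]
    by (metis (lifting) card_Un_disjoint finite_Un)
  then show ?thesis
    using card_proper_colorings_contract[OF sg e] simple_graph_edge_endpoints[OF sg e]
    by (simp add: contract_def merge_def)
qed

lemma graph_chromatic_poly_delete_contract:
  assumes sg: "simple_graph V E" and e: "{u, v} \<in> E"
  shows "graph_chromatic_poly V E =
    graph_chromatic_poly V (E - {{u, v}}) - graph_chromatic_poly (V - {v}) (contract u v E)"
  by (rule int_poly_eqI_nat)
    (simp add: poly_graph_chromatic_poly sg simple_graph_delete simple_graph_contract[OF sg e]
      card_proper_colorings_delete_contract[OF sg e])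

lemma graph_chromatic_poly_empty:
  assumes "finite V"
  shows "graph_chromatic_poly V {} = monom 1 (card V)"
proof (rule int_poly_eqI_nat)
  fix k
  have "simple_graph V {}" using assms by (simp add: simple_graph_def)
  moreover have "card (proper_colorings V {} k) = k ^ card V"
    using assms by (simp add: proper_colorings_def card_PiE)
  ultimately show "poly (graph_chromatic_poly V {}) (int k) = poly (monom 1 (card V)) (int k)"
    by (simp add: poly_graph_chromatic_poly poly_monom)
qed

section \<open>Rank\<close>

lemma graph_components_eq_conn_classes: "graph_components V E = conn_classes V (adjacency E)"
  by (simp add: graph_components_def adjacency_def)

lemma graph_rank_empty: "graph_rank V {} = 0"
  by (simp add: graph_rank_def graph_components_eq_conn_classes adjacency_def
      card_conn_classes_empty)

lemma graph_rank_mono: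
  assumes "finite V" "D \<subseteq> E"
  shows "graph_rank V D \<le> graph_rank V E"
proof -
  have "adjacency D \<subseteq> adjacency E" using assms(2) by (auto simp: adjacency_def)
  then show ?thesis
    unfolding graph_rank_def graph_components_eq_conn_classes
    by (intro diff_le_mono2 card_conn_classes_antimono assms(1))
qed

lemma map_prod_merge_adjacency:
  assumes sg: "simple_graph V E" and e: "{u, v} \<in> E"
  shows "map_prod (merge u v) (merge u v) ` adjacency E =
    insert (u, u) (adjacency (contract u v E))"
    (is "?m ` _ = _")
proof (intro equalityI subsetI)
  fix p assume "p \<in> ?m ` adjacency E"
  then obtain a b where ab: "{a, b} \<in> E" "p = (merge u v a, merge u v b)"
    by (auto simp: adjacency_def)
  show "p \<in> insert (u, u) (adjacency (contract u v E))"
  proof (cases "{a, b} = {u, v}")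
    case True
    then show ?thesis using ab(2) by (auto simp: merge_def doubleton_eq_iff)
  next
    case False
    then have "merge u v ` {a, b} \<in> contract u v E"
      using ab(1) unfolding contract_def by blast
    then show ?thesis using ab(2) by (simp add: adjacency_def)
  qed
next
  fix p assume "p \<in> insert (u, u) (adjacency (contract u v E))"
  then consider (loop) "p = (u, u)" | (edge) x y where "p = (x, y)" "{x, y} \<in> contract u v E"
    by (auto simp: adjacency_def)
  then show "p \<in> ?m ` adjacency E"
  proof cases
    case loop
    have "(u, v) \<in> adjacency E" using e by (simp add: adjacency_def)
    then show ?thesis by (rule rev_image_eqI) (simp add: loop merge_def)
  next
    case (edge x y)
    then obtain d where d: "d \<in> E" "{x, y} = merge u v ` d" by (auto simp: contract_def)
    then obtain a b where ab: "d = {a, b}" using sg by (auto simp: simple_graph_def card_2_iff)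
    then have "(a, b) \<in> adjacency E" "(b, a) \<in> adjacency E"
      using d(1) by (simp_all add: adjacency_def insert_commute)
    moreover have "p = ?m (a, b) \<or> p = ?m (b, a)"
      using d(2) ab edge(1) by (auto simp: doubleton_eq_iff)
    ultimately show ?thesis by blast
  qed
qed

lemma card_graph_components_contract:
  assumes sg: "simple_graph V E" and e: "{u, v} \<in> E"
  shows "card (graph_components (V - {v}) (contract u v E)) = card (graph_components V E)"
proof -
  have uv: "u \<in> V" "v \<in> V" "u \<noteq> v" using simple_graph_edge_endpoints[OF sg e] by auto
  have uv_connected: "(u, v) \<in> connection (adjacency E)"
    using e by (intro connection_base) (simp add: adjacency_def)
  have kernel: "(x, y) \<in> connection (adjacency E)" if "merge u v x = merge u v y" for x y
    using that uv_connected connection_sym[OF uv_connected] by (auto simp: merge_eq_iff)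
  have "conn_classes (V - {v}) (adjacency (contract u v E)) =
      conn_classes (merge u v ` V) (map_prod (merge u v) (merge u v) ` adjacency E)"
    by (simp add: merge_image[OF uv] map_prod_merge_adjacency[OF sg e] conn_classes_eq_quotient
        connection_on_def connection_insert_loop)
  then show ?thesis
    using card_conn_classes_map_prod[of "merge u v" "adjacency E" V, OF kernel]
    by (simp add: graph_components_eq_conn_classes)
qed

lemma card_graph_components_le:
  assumes "finite V"
  shows "card (graph_components V E) \<le> card V"
  using card_conn_classes_antimono[OF assms, of "{}" "adjacency E"]
  by (simp add: graph_components_eq_conn_classes card_conn_classes_empty)

lemma graph_rank_contract:
  assumes sg: "simple_graph V E" and e: "{u, v} \<in> E"
  shows "graph_rank V E = Suc (graph_rank (V - {v}) (contract u v E))"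
proof -
  have fin: "finite V" and "v \<in> V"
    using simple_graph_finite_verts[OF sg] simple_graph_edge_endpoints[OF sg e] by auto
  then have "card V = Suc (card (V - {v}))" by (simp add: card_Suc_Diff1 del: card_Diff_insert)
  then show ?thesis
    using card_graph_components_le[of "V - {v}" "contract u v E"] fin
    by (simp add: graph_rank_def card_graph_components_contract[OF sg e])
qed

section \<open>Signs of the Whitney numbers of a graph\<close>

lemma graph_whitney_eq_coeff:
  assumes "j \<le> card V"
  shows "graph_whitney V E j = (- 1) ^ j * coeff (graph_chromatic_poly V E) (card V - j)"
proof -
  have "(- 1 :: int) ^ card V * (- 1) ^ (card V - j) = (- 1) ^ j"
    using assms by (auto simp: minus_one_power_iff)
  then show ?thesis
    by (simp add: graph_whitney_def signless_poly_def coeff_pcompose_linear mult.assoc[symmetric])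
qed

lemma graph_whitney_empty:
  assumes "finite V" "j \<le> card V"
  shows "graph_whitney V {} j = (if j = 0 then 1 else 0)"
  using assms by (auto simp: graph_whitney_eq_coeff graph_chromatic_poly_empty)

lemma graph_whitney_delete_contract:
  assumes sg: "simple_graph V E" and e: "{u, v} \<in> E"
  shows graph_whitney_delete_0: "graph_whitney V E 0 = graph_whitney V (E - {{u, v}}) 0"
    and graph_whitney_delete_contract_Suc: "Suc j \<le> card V \<Longrightarrow> graph_whitney V E (Suc j) =
      graph_whitney V (E - {{u, v}}) (Suc j) + graph_whitney (V - {v}) (contract u v E) j"
proof -
  have "finite V" "v \<in> V"
    using simple_graph_finite_verts[OF sg] simple_graph_edge_endpoints[OF sg e] by auto
  then have n: "card V = Suc (card (V - {v}))" by (metis card_Suc_Diff1)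
  then have "coeff (graph_chromatic_poly (V - {v}) (contract u v E)) (card V) = 0"
    using degree_graph_chromatic_poly[OF simple_graph_contract[OF sg e]]
    by (intro coeff_eq_0) simp
  then show "graph_whitney V E 0 = graph_whitney V (E - {{u, v}}) 0"
    by (simp add: graph_whitney_eq_coeff graph_chromatic_poly_delete_contract[OF sg e])
  show "graph_whitney V E (Suc j) =
      graph_whitney V (E - {{u, v}}) (Suc j) + graph_whitney (V - {v}) (contract u v E) j"
    if "Suc j \<le> card V"
    using that n
    by (simp add: graph_whitney_eq_coeff graph_chromatic_poly_delete_contract[OF sg e]
        algebra_simps)
qed

lemma sgn_graph_whitney:
  assumes "simple_graph V E" "j \<le> card V"
  shows "sgn (graph_whitney V E j) = (if j \<le> graph_rank V E then 1 else 0)"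
  using assms
proof (induction V E arbitrary: j rule: delete_contract_induct)
  case (empty V)
  then show ?case by (simp add: graph_whitney_empty graph_rank_empty)
next
  case (edge V E u v)
  let ?D = "E - {{u, v}}" and ?C = "contract u v E"
  have fin: "finite V" and "v \<in> V"
    using simple_graph_finite_verts[OF edge.hyps(1)] simple_graph_edge_endpoints[OF edge.hyps(1,2)]
    by auto
  show ?case
  proof (cases j)
    case 0
    then show ?thesis
      using edge.IH(1)[of 0] by (simp add: graph_whitney_delete_0[OF edge.hyps(1,2)])
  next
    case (Suc i)
    have rank: "graph_rank V E = Suc (graph_rank (V - {v}) ?C)" "graph_rank V ?D \<le> graph_rank V E"
      by (rule graph_rank_contract[OF edge.hyps(1,2)]) (rule graph_rank_mono[OF fin Diff_subset])
    have "i \<le> card (V - {v})" using edge.prems Suc fin \<open>v \<in> V\<close> by simp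
    then have C: "sgn (graph_whitney (V - {v}) ?C i) = (if j \<le> graph_rank V E then 1 else 0)"
      using edge.IH(2) rank(1) Suc by simp
    have D: "sgn (graph_whitney V ?D j) = (if j \<le> graph_rank V ?D then 1 else 0)"
      using edge.IH(1) edge.prems by simp
    have "graph_whitney V E j = graph_whitney V ?D j + graph_whitney (V - {v}) ?C i"
      using graph_whitney_delete_contract_Suc[OF edge.hyps(1,2)] edge.prems Suc by simp
    moreover have "graph_whitney V ?D j \<ge> 0"
      using D by (cases "j \<le> graph_rank V ?D") (simp_all add: sgn_1_pos sgn_0_0)
    ultimately show ?thesis
      using C D rank(2) by (cases "j \<le> graph_rank V E") (simp_all add: sgn_1_pos sgn_0_0)
  qed
qed

lemma graph_whitney_pos:
  assumes "simple_graph V E" "j \<le> graph_rank V E"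
  shows "graph_whitney V E j > 0"
proof -
  have "j \<le> card V" using assms(2) by (simp add: graph_rank_def)
  then have "sgn (graph_whitney V E j) = 1" using sgn_graph_whitney[OF assms(1)] assms(2) by simp
  then show ?thesis by (simp add: sgn_1_pos)
qed

lemma graph_whitney_eq_0:
  assumes "simple_graph V E" "graph_rank V E < j" "j \<le> card V"
  shows "graph_whitney V E j = 0"
  using sgn_graph_whitney[OF assms(1,3)] assms(2) by (simp add: sgn_0_0)

theorem theorem1:
  fixes V :: "'v set" and E :: "'v set set" and G :: "('g, 'm) monoid_scheme"
    and ori :: "'v set \<Rightarrow> 'v \<times> 'v" and n c \<gamma> i :: nat
  assumes "simple_graph V E" and "card V = n" and "n > 0"
    and "card (graph_components V E) = c"
    and "orients ori E"
    and "group G" and "finite (carrier G)" and "Coset.order G = \<gamma>" and "\<gamma> > 0"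
    and "i \<le> n"
  shows "gain_whitney G (full_expansion G V E ori) i =
           (\<Sum>j = 0..i. graph_whitney V E j * int ((n - j) choose (i - j)) * int \<gamma> ^ j)
         \<and> (let p = (\<Sum>j = 0..i. monom (graph_whitney V E j * int ((n - j) choose (i - j))) j)
            in gain_whitney G (full_expansion G V E ori) i = poly p (int \<gamma>)
               \<and> degree p = min i (n - c)
               \<and> (\<forall>j \<le> degree p. coeff p j > 0))"
proof -
  define p where "p = (\<Sum>j = 0..i. monom (graph_whitney V E j * int ((n - j) choose (i - j))) j)"
  have rank: "graph_rank V E = n - c" using assms(2,4) by (simp add: graph_rank_def)
  have whitney: "gain_whitney G (full_expansion G V E ori) i =
      (\<Sum>j = 0..i. graph_whitney V E j * int ((n - j) choose (i - j)) * int \<gamma> ^ j)"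
    using gain_whitney_full_expansion[of V E ori G i] assms by simp
  also have "\<dots> = poly p (int \<gamma>)" by (simp add: p_def poly_sum poly_monom)
  finally have poly_p: "gain_whitney G (full_expansion G V E ori) i = poly p (int \<gamma>)" .
  have coeff_p: "coeff p j =
      (if j \<le> i then graph_whitney V E j * int ((n - j) choose (i - j)) else 0)" for j
    by (auto simp: p_def coeff_sum)
  have pos: "coeff p j > 0" if "j \<le> min i (n - c)" for j
    using that graph_whitney_pos[OF assms(1)] rank assms(10) by (simp add: coeff_p)
  have "coeff p j = 0" if "j > min i (n - c)" for j
    using that graph_whitney_eq_0[OF assms(1)] rank assms(2,10) by (auto simp: coeff_p)
  then have "degree p = min i (n - c)"
    using pos[of "min i (n - c)"] by (intro antisym degree_le le_degree) auto
  then show ?thesis using whitney poly_p pos by (simp add: Let_def flip: p_def)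
qed

end
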